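(* Let $n,d\ge 1$. The set $$S_{n,d}=\left\{(\alpha_1,\dots,\alpha_n)\in\mathbb{R}^n : \alpha_i\in\mathbb{Z},\ \alpha_i\ge 0,\ \sum_{i=1}^n\alpha_i=d,\ \text{at least two of the } \alpha_i \text{ are nonzero}\right\},$$ which has cardinality $\binom{n+d-1}{d}-n$, is $d$-independent. Consequently, for every integer $k$ with $1\le k\le\binom{n+d-1}{d}-n$, the set of $d$-independent configurations of $k$ points in $\mathbb{RP}^{n-1}$ is a nonempty open subset of $(\mathbb{RP}^{n-1})^k$.
   Context: $P_{n,d}$ denotes the real vector space of forms in $n$ variables of degree $d$ with real coefficients. Finite sets $S\subset\mathbb{R}^n$ consist of nonzero vectors and are thought of projectively, i.e. as sets of distinct points of $\mathbb{RP}^{n-1}$. $I_{1,d}(S)=\{p\in P_{n,d} : p(s)=0\ \forall s\in S\}$. A form vanishes to order 2 at $s$ if all its first partial derivatives vanish at $s$. A finite set $S$ is called $d$-independent if: (1) $S$ forces no additional zeroes for forms of degree $d$ that vanish on $S$, i.e. the set of common zeroes in $\mathbb{RP}^{n-1}$ of the forms in $I_{1,d}(S)$ is exactly $S$; and (2) for every $s\in S$, the forms in $P_{n,d}$ that vanish to order 2 at $s$ and vanish on the rest of $S$ form a vector subspace of codimension $|S|+n-1$ in $P_{n,d}$. A configuration of $k$ points is a $k$-tuple of distinct points, and it is $d$-independent if the set of its points is. *)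

theory Defs
  imports "HOL-Analysis.Analysis" "HOL-Analysis.Finite_Function_Topology"
begin

text \<open>
  The number \<open>n\<close> of variables is \<open>CARD('n)\<close>. A polynomial in these variables is a finitely
  supported map from exponent vectors to coefficients; its real vector space structure is the one
  of \<^theory>\<open>HOL-Analysis.Finite_Function_Topology\<close>.
\<close>

type_synonym 'n mpoly = "(nat ^ 'n) \<Rightarrow>\<^sub>0 real"

definition forms :: "nat \<Rightarrow> 'n::finite mpoly set" where
  "forms d = {p. \<forall>a \<in> Poly_Mapping.keys p. (\<Sum>i\<in>UNIV. a $ i) = d}"

definition mpoly_eval :: "'n::finite mpoly \<Rightarrow> real ^ 'n \<Rightarrow> real" where
  "mpoly_eval p x = (\<Sum>a\<in>Poly_Mapping.keys p. Poly_Mapping.lookup p a * (\<Prod>i\<in>UNIV. (x $ i) ^ (a $ i)))"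

definition vanishes_to_order_2 :: "'n::finite mpoly \<Rightarrow> real ^ 'n \<Rightarrow> bool" where
  "vanishes_to_order_2 p s \<longleftrightarrow>
     (\<forall>i. ((\<lambda>t. mpoly_eval p (s + t *\<^sub>R axis i 1)) has_real_derivative 0) (at 0))"

definition vanishing_forms :: "nat \<Rightarrow> (real ^ 'n::finite) set \<Rightarrow> 'n mpoly set" where
  "vanishing_forms d S = {p \<in> forms d. \<forall>s\<in>S. mpoly_eval p s = 0}"

definition doubly_vanishing_forms :: "nat \<Rightarrow> (real ^ 'n::finite) set \<Rightarrow> real ^ 'n \<Rightarrow> 'n mpoly set" where
  "doubly_vanishing_forms d S s =
     {p \<in> forms d. vanishes_to_order_2 p s \<and> (\<forall>t \<in> S - {s}. mpoly_eval p t = 0)}"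

text \<open>
  A point of real projective space is the line through the origin, as a subset of \<open>real ^ 'n\<close>,
  spanned by a nonzero vector. The topology is the quotient topology; see
  \<open>quotient_map_proj_point\<close> below.
\<close>

definition proj_point :: "real ^ 'n::finite \<Rightarrow> (real ^ 'n) set" where
  "proj_point x = span {x}"

definition projective_space :: "(real ^ 'n::finite) set topology" where
  "projective_space = topology (\<lambda>U. U \<subseteq> proj_point ` (- {0}) \<and>
     openin (top_of_set (- {0})) {x \<in> - {0}. proj_point x \<in> U})"

lemma openin_projective_space:
  fixes U :: "(real ^ 'n::finite) set set"
  shows "openin projective_space U \<longleftrightarrow> U \<subseteq> proj_point ` (- {0}) \<and>
     openin (top_of_set (- {0})) {x \<in> - {0}. proj_point x \<in> U}"
proof -
  let ?P = "\<lambda>U :: (real ^ 'n) set set. U \<subseteq> proj_point ` (- {0}) \<and>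
     openin (top_of_set (- {0})) {x \<in> - {0 :: real ^ 'n}. proj_point x \<in> U}"
  have "istopology ?P"
    unfolding istopology_def
  proof (intro conjI allI impI)
    fix U V :: "(real ^ 'n) set set" assume "?P U" "?P V"
    moreover have "{x \<in> - {0}. proj_point x \<in> U \<inter> V} =
        {x \<in> - {0}. proj_point x \<in> U} \<inter> {x \<in> - {0}. proj_point x \<in> V}"
      by blast
    ultimately show "openin (top_of_set (- {0})) {x \<in> - {0}. proj_point x \<in> U \<inter> V}"
      by (metis (no_types, lifting) openin_Int)
  next
    fix K :: "(real ^ 'n) set set set" assume K: "\<forall>U\<in>K. ?P U"
    have "{x \<in> - {0}. proj_point x \<in> \<Union>K} =
        \<Union>((\<lambda>U. {x \<in> - {0}. proj_point x \<in> U}) ` K)"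
      by blast
    moreover have "openin (top_of_set (- {0})) (\<Union>((\<lambda>U. {x \<in> - {0}. proj_point x \<in> U}) ` K))"
      using K by (intro openin_Union) auto
    ultimately show "openin (top_of_set (- {0})) {x \<in> - {0}. proj_point x \<in> \<Union>K}"
      by simp
  qed blast+
  then show ?thesis
    unfolding projective_space_def by (simp add: topology_inverse')
qed

lemma topspace_projective_space:
  "topspace projective_space = proj_point ` (- {0 :: real ^ 'n::finite})"
proof (rule antisym)
  show "topspace projective_space \<subseteq> proj_point ` (- {0 :: real ^ 'n})"
    using openin_projective_space openin_topspace by blast
  have "{x \<in> - {0}. proj_point x \<in> proj_point ` (- {0})} = - {0 :: real ^ 'n}"
    by blast
  then have "openin projective_space (proj_point ` (- {0 :: real ^ 'n}))"
    unfolding openin_projective_space by simp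
  then show "proj_point ` (- {0 :: real ^ 'n}) \<subseteq> topspace projective_space"
    by (rule openin_subset)
qed

lemma quotient_map_proj_point:
  "quotient_map (top_of_set (- {0})) projective_space proj_point"
  unfolding quotient_map_def by (auto simp: topspace_projective_space openin_projective_space)

text \<open>
  The two dimensions in the last clause are those of finite-dimensional spaces, one contained in
  the other, so that clause says that the smaller one has codimension \<open>card S + CARD('n) - 1\<close>.
\<close>

definition d_independent :: "nat \<Rightarrow> (real ^ 'n::finite) set \<Rightarrow> bool" where
  "d_independent d S \<longleftrightarrow>
     finite S \<and> 0 \<notin> S \<and> inj_on proj_point S \<and>
     proj_point ` {x. x \<noteq> 0 \<and> (\<forall>p \<in> vanishing_forms d S. mpoly_eval p x = 0)} = proj_point ` S \<and>
     (\<forall>s\<in>S. dim (forms d :: 'n mpoly set) =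
        dim (doubly_vanishing_forms d S s) + (card S + CARD('n) - 1))"

text \<open>
  Configurations of \<open>k\<close> points are tuples indexed by \<open>{..<k}\<close>, extended by \<open>undefined\<close> as in
  \<^const>\<open>product_topology\<close>. Rescaling the vectors of \<open>S\<close> does not affect
  \<^const>\<open>d_independent\<close>, so the choice of representatives of the points is immaterial.
\<close>

definition d_independent_configurations ::
    "nat \<Rightarrow> nat \<Rightarrow> (nat \<Rightarrow> (real ^ 'n::finite) set) set" where
  "d_independent_configurations d k =
     {c \<in> topspace (product_topology (\<lambda>_. projective_space) {..<k}).
        inj_on c {..<k} \<and> (\<exists>S. d_independent d S \<and> proj_point ` S = c ` {..<k})}"

definition lattice_set :: "nat \<Rightarrow> (real ^ 'n::finite) set" where
  "lattice_set d = {a. (\<forall>i. a $ i \<in> \<int> \<and> a $ i \<ge> 0) \<and> (\<Sum>i\<in>UNIV. a $ i) = real d \<and>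
     card {i. a $ i \<noteq> 0} \<ge> 2}"

end

theory Submission
  imports Defs
begin

text \<open>
  For a configuration \<open>S\<close> the codimension condition at a point \<open>s\<close> says that the evaluations at the other
  points and the partial derivatives at \<open>s\<close> are independent functionals on the forms of degree \<open>d\<close>
  (\<open>independent_functionals_iff_codim\<close>, \<open>d_independent_image_iff\<close>).

  The lattice points. Two kinds of products of linear forms do everything. For a variable \<open>i\<close>, the
  form \<open>\<Prod>k<d. (d x_i - k (x_1 + \<dots> + x_n))\<close> vanishes on all lattice points. The common zeroes of
  these \<open>n\<close> forms are exactly the lattice points, and their gradients at a lattice point \<open>s\<close> annihilate
  no direction other than that of \<open>s\<close> (\<open>coordinate_form_lattice\<close>, \<open>coordinate_forms_zero\<close>). For a lattice
  point \<open>a\<close>, the form \<open>\<Prod>i. \<Prod>k<a_i. (d x_i - k (x_1 + \<dots> + x_n))\<close> vanishes at all lattice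
  points but \<open>a\<close> (\<open>lagrange_form\<close>). Together they show that every set of lattice points, not only the full
  one, is \<open>d\<close>-independent (\<open>d_independent_subset_lattice_set\<close>), which yields independent
  configurations of every size up to the cardinality of the lattice set.

  Openness. Independence of functionals is stable under small changes
  (\<open>eventually_independent_functionals\<close>), so the codimension condition is open. For the absence of
  additional zeroes, suppose that configurations tending to an independent one have additional zeroes.
  By compactness these accumulate somewhere. Away from the limit configuration this contradicts the
  absence of additional zeroes there; at a point \<open>s\<close> of it, two zeroes merge, and in the limit all forms
  vanishing on the configuration have derivative zero at \<open>s\<close> in a direction transversal to \<open>s\<close>, which
  contradicts the codimension condition (\<open>no_additional_zero_limit\<close>).
\<close>

section \<open>Independent linear functionals\<close>

definition independent_functionals ::
    "'v::real_vector set \<Rightarrow> 'i set \<Rightarrow> ('i \<Rightarrow> 'v \<Rightarrow> real) \<Rightarrow> bool" where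
  "independent_functionals V I f \<longleftrightarrow>
     (\<forall>c. (\<forall>p\<in>V. (\<Sum>i\<in>I. c i * f i p) = 0) \<longrightarrow> (\<forall>i\<in>I. c i = 0))"

lemma independent_functionalsD:
  assumes "independent_functionals V I f" "\<And>p. p \<in> V \<Longrightarrow> (\<Sum>i\<in>I. c i * f i p) = 0" "i \<in> I"
  shows "c i = 0"
  using assms unfolding independent_functionals_def by blast

lemma subspace_common_kernel:
  fixes f :: "'i \<Rightarrow> 'v::real_vector \<Rightarrow> real"
  assumes V: "subspace V" and f: "\<And>i. i \<in> I \<Longrightarrow> linear (f i)"
  shows "subspace {p\<in>V. \<forall>i\<in>I. f i p = 0}"
  using V f by (auto simp: subspace_def linear_0 linear_add linear_cmul)

lemma independent_functionalsI_dual: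
  assumes "finite I"
    and dual: "\<And>i. i \<in> I \<Longrightarrow> \<exists>e\<in>V. \<forall>j\<in>I. f j e = (if j = i then 1 else 0)"
  shows "independent_functionals V I f"
  unfolding independent_functionals_def
proof (intro allI impI ballI)
  fix c i
  assume c: "\<forall>p\<in>V. (\<Sum>i\<in>I. c i * f i p) = 0" and i: "i \<in> I"
  obtain e where e: "e \<in> V" "\<forall>j\<in>I. f j e = (if j = i then 1 else 0)"
    using dual[OF i] by blast
  have "(\<Sum>j\<in>I. c j * f j e) = (\<Sum>j\<in>I. if j = i then c j else 0)"
    using e by (intro sum.cong) auto
  also have "\<dots> = c i"
    using \<open>finite I\<close> i by simp
  finally show "c i = 0" using bspec[OF c e(1)] by simp
qed

lemma independent_functionals_subset:
  assumes "independent_functionals V I f" "J \<subseteq> I" "finite I"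
  shows "independent_functionals V J f"
  unfolding independent_functionals_def
proof (intro allI impI ballI)
  fix c i
  assume c: "\<forall>p\<in>V. (\<Sum>i\<in>J. c i * f i p) = 0" and i: "i \<in> J"
  let ?c = "\<lambda>i. if i \<in> J then c i else 0"
  have "(\<Sum>i\<in>I. ?c i * f i p) = (\<Sum>i\<in>J. c i * f i p)" for p
    by (rule sum.mono_neutral_cong_right) (use assms(2,3) in auto)
  then have "\<forall>p\<in>V. (\<Sum>i\<in>I. ?c i * f i p) = 0"
    using c by simp
  then have "?c i = 0"
    using i assms(2) by (intro independent_functionalsD[OF assms(1), of ?c]) auto
  then show "c i = 0" using i by simp
qed

text \<open>
  The duality behind most arguments below: independent functionals can be prescribed one at a
  time. When a functional \<open>a\<close> is added, independence gives a \<open>p\<close> on which \<open>f a\<close> differs from its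
  interpolation by the old functionals; subtracting from \<open>p\<close> its interpolation by the old dual
  vectors yields the new dual vector, and the old ones are then corrected by multiples of it.
\<close>

lemma independent_functionals_dual:
  fixes f :: "'i \<Rightarrow> 'v::real_vector \<Rightarrow> real"
  assumes V: "subspace V" and fin: "finite I" and lin: "\<And>i. i \<in> I \<Longrightarrow> linear (f i)"
    and ind: "independent_functionals V I f"
  shows "\<exists>e. \<forall>i\<in>I. e i \<in> V \<and> (\<forall>j\<in>I. f j (e i) = (if j = i then 1 else 0))"
  using fin lin ind
proof (induction I rule: finite_induct)
  case empty
  then show ?case by simp
next
  case (insert a I)
  have "independent_functionals V I f"
    using insert.prems(2) by (rule independent_functionals_subset) (use insert.hyps in auto)
  then obtain e where e: "\<forall>i\<in>I. e i \<in> V \<and> (\<forall>j\<in>I. f j (e i) = (if j = i then 1 else 0))"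
    using insert.IH insert.prems(1) by (metis insertCI)
  let ?c = "\<lambda>i. if i = a then 1 else - f a (e i)"
  have "\<exists>p\<in>V. (\<Sum>i\<in>insert a I. ?c i * f i p) \<noteq> 0"
  proof (rule ccontr)
    assume "\<not> ?thesis"
    then have "?c a = 0"
      by (intro independent_functionalsD[OF insert.prems(2), of ?c]) auto
    then show False by simp
  qed
  then obtain p where p: "p \<in> V" "(\<Sum>i\<in>insert a I. ?c i * f i p) \<noteq> 0" by blast
  have "(\<Sum>i\<in>insert a I. ?c i * f i p) = f a p - (\<Sum>i\<in>I. f a (e i) * f i p)"
    using insert.hyps by (auto simp: sum_negf[symmetric] intro!: sum.cong)
  define q where "q = p - (\<Sum>i\<in>I. f i p *\<^sub>R e i)"
  have fq: "f j q = f j p - (\<Sum>i\<in>I. f i p * f j (e i))" if "j \<in> insert a I" for j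
    using insert.prems(1)[OF that] unfolding q_def
    by (simp add: linear_diff linear_sum linear_cmul)
  have qV: "q \<in> V"
    unfolding q_def using e p V by (intro subspace_diff subspace_sum subspace_scale) auto
  have q0: "f j q = 0" if "j \<in> I" for j
  proof -
    have "(\<Sum>i\<in>I. f i p * f j (e i)) = (\<Sum>i\<in>I. if i = j then f i p else 0)"
      using e that by (intro sum.cong) auto
    then show ?thesis using fq that insert.hyps by simp
  qed
  have qa: "f a q \<noteq> 0"
    using p \<open>(\<Sum>i\<in>insert a I. ?c i * f i p) = f a p - (\<Sum>i\<in>I. f a (e i) * f i p)\<close> fq[of a]
    by (simp add: mult.commute)
  define ea where "ea = (1 / f a q) *\<^sub>R q"
  have ea: "ea \<in> V" "f a ea = 1" "\<And>j. j \<in> I \<Longrightarrow> f j ea = 0"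
    using insert.prems(1) qV V qa q0 by (auto simp: ea_def linear_cmul subspace_scale)
  let ?e = "\<lambda>i. if i = a then ea else e i - f a (e i) *\<^sub>R ea"
  have "?e i \<in> V \<and> (\<forall>j\<in>insert a I. f j (?e i) = (if j = i then 1 else 0))" if "i \<in> insert a I" for i
    using that e ea insert.prems(1) insert.hyps V
    by (auto simp: linear_diff linear_cmul subspace_diff subspace_scale)
  then show ?case by (intro exI[of _ ?e]) blast
qed

lemma dim_kernel_functional:
  fixes f :: "'v::real_vector \<Rightarrow> real"
  assumes V: "subspace V" and T: "finite T" "V \<subseteq> span T" and lin: "linear f"
    and q: "q \<in> V" "f q \<noteq> 0"
  shows "dim V = Suc (dim {p\<in>V. f p = 0})"
proof -
  let ?K = "{p\<in>V. f p = 0}"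
  obtain B where B: "B \<subseteq> ?K" "independent B" "?K \<subseteq> span B" "card B = dim ?K"
    by (rule basis_exists)
  have "finite B"
    using independent_span_bound[OF T(1) B(2)] B(1) T(2) by blast
  have K: "subspace ?K"
    using V lin by (auto simp: subspace_def linear_0 linear_add linear_cmul)
  then have spB: "span B \<subseteq> ?K" using B(1) by (simp add: span_minimal)
  have qB: "q \<notin> span B" using spB q by blast
  have "dim V = card (insert q B)"
  proof (rule dim_unique[of "insert q B"])
    show "insert q B \<subseteq> V" using B q by blast
    show "V \<subseteq> span (insert q B)"
    proof
      fix p assume p: "p \<in> V"
      have "p - (f p / f q) *\<^sub>R q \<in> ?K"
        using p q V lin by (auto simp: linear_diff linear_cmul subspace_diff subspace_scale)
      then show "p \<in> span (insert q B)"
        using B(3) by (auto simp: span_insert)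
    qed
    show "independent (insert q B)" using qB B(2) by (simp add: independent_insertI)
  qed simp
  also have "\<dots> = Suc (card B)"
    using \<open>finite B\<close> qB by (meson card_insert_disjoint span_base)
  finally show ?thesis using B by simp
qed

lemma codim_common_kernel_le:
  fixes f :: "'i \<Rightarrow> 'v::real_vector \<Rightarrow> real"
  assumes V: "subspace V" and T: "finite T" "V \<subseteq> span T" and fin: "finite I"
    and lin: "\<And>i. i \<in> I \<Longrightarrow> linear (f i)"
  shows "dim V \<le> dim {p\<in>V. \<forall>i\<in>I. f i p = 0} + card I"
  using fin lin
proof (induction I rule: finite_induct)
  case empty
  then show ?case by simp
next
  case (insert a I)
  let ?K = "{p\<in>V. \<forall>i\<in>I. f i p = 0}"
  let ?L = "{p\<in>V. \<forall>i\<in>insert a I. f i p = 0}"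
  have eq: "?L = {p\<in>?K. f a p = 0}" by auto
  have "dim ?K \<le> Suc (dim ?L)"
  proof (cases "\<exists>q\<in>?K. f a q \<noteq> 0")
    case True
    then obtain q where "q \<in> ?K" "f a q \<noteq> 0" by blast
    then show ?thesis
      unfolding eq using T insert.prems
      by (subst dim_kernel_functional[of ?K T "f a" q])
        (auto intro!: subspace_common_kernel V)
  next
    case False
    then have "?L = ?K" by auto
    then show ?thesis by simp
  qed
  then show ?case using insert by simp
qed

text \<open>
  This turns the codimension condition in the definition of \<open>d\<close>-independence into a statement
  about functionals, which is better suited to limits. If the codimension is full, then dropping
  one functional must enlarge the common kernel, and a vector in the difference is, up to a
  scalar, the dual vector of that functional.
\<close>

lemma independent_functionals_iff_codim:
  fixes f :: "'i \<Rightarrow> 'v::real_vector \<Rightarrow> real"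
  assumes V: "subspace V" and T: "finite T" "V \<subseteq> span T" and fin: "finite I"
    and lin: "\<And>i. i \<in> I \<Longrightarrow> linear (f i)"
  shows "independent_functionals V I f \<longleftrightarrow>
           dim V = dim {p\<in>V. \<forall>i\<in>I. f i p = 0} + card I"
proof
  assume "independent_functionals V I f"
  with fin lin show "dim V = dim {p\<in>V. \<forall>i\<in>I. f i p = 0} + card I"
  proof (induction I rule: finite_induct)
    case empty
    then show ?case by simp
  next
    case (insert a I)
    let ?K = "{p\<in>V. \<forall>i\<in>I. f i p = 0}"
    let ?L = "{p\<in>V. \<forall>i\<in>insert a I. f i p = 0}"
    have eq: "?L = {p\<in>?K. f a p = 0}" by auto
    obtain e where e: "\<forall>i\<in>insert a I. e i \<in> V \<and> (\<forall>j\<in>insert a I. f j (e i) = (if j = i then 1 else 0))"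
      using independent_functionals_dual[OF V _ insert.prems(1) insert.prems(2)] insert.hyps(1) by auto
    have "dim ?K = Suc (dim ?L)"
      unfolding eq using T insert.prems insert.hyps e
      by (intro dim_kernel_functional[of ?K T "f a" "e a"])
        (auto intro!: subspace_common_kernel V)
    moreover have "independent_functionals V I f"
      using insert.prems(2) by (rule independent_functionals_subset) (use insert.hyps in auto)
    ultimately show ?case using insert by simp
  qed
next
  assume dims: "dim V = dim {p\<in>V. \<forall>i\<in>I. f i p = 0} + card I"
  show "independent_functionals V I f"
  proof (rule independent_functionalsI_dual[OF fin])
    fix i assume i: "i \<in> I"
    let ?K = "{p\<in>V. \<forall>j\<in>I - {i}. f j p = 0}"
    have "\<exists>q\<in>?K. f i q \<noteq> 0"
    proof (rule ccontr)
      assume "\<not> ?thesis"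
      then have "{p\<in>V. \<forall>i\<in>I. f i p = 0} = ?K" by auto
      moreover have "dim V \<le> dim ?K + card (I - {i})"
        using fin lin by (intro codim_common_kernel_le[OF V T]) auto
      moreover have "card I = Suc (card (I - {i}))"
        using fin i by (rule card.remove)
      ultimately show False using dims by simp
    qed
    then obtain q where q: "q \<in> ?K" "f i q \<noteq> 0" by blast
    show "\<exists>e\<in>V. \<forall>j\<in>I. f j e = (if j = i then 1 else 0)"
      using q V lin by (intro bexI[of _ "(1 / f i q) *\<^sub>R q"]) (auto simp: linear_cmul subspace_scale)
  qed
qed

text \<open>
  Independence is an open condition, and needs only pointwise convergence of the functionals on
  \<open>V\<close>. On the finitely many vectors dual to the limit the matrix of the functionals tends to the
  identity matrix, so it is eventually diagonally dominant and hence nonsingular.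
\<close>

lemma eventually_independent_functionals:
  fixes f :: "'i \<Rightarrow> 'v::real_vector \<Rightarrow> real"
  assumes V: "subspace V" and fin: "finite I" and lin: "\<And>i. i \<in> I \<Longrightarrow> linear (f i)"
    and ind: "independent_functionals V I f"
    and lim: "\<And>i p. i \<in> I \<Longrightarrow> p \<in> V \<Longrightarrow> ((\<lambda>m. g m i p) \<longlongrightarrow> f i p) F"
  shows "eventually (\<lambda>m. independent_functionals V I (g m)) F"
proof -
  obtain e where e: "\<And>i. i \<in> I \<Longrightarrow> e i \<in> V"
      "\<And>i j. i \<in> I \<Longrightarrow> j \<in> I \<Longrightarrow> f j (e i) = (if j = i then 1 else 0)"
    using independent_functionals_dual[OF V fin lin ind] by metis
  \<comment> \<open>Small enough that a row of \<open>card I\<close> errors of size \<open>\<delta>\<close> does not outweigh the entry \<open>1\<close>.\<close>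
  define \<delta> :: real where "\<delta> = 1 / (2 * (real (card I) + 1))"
  have \<delta>: "\<delta> > 0" "real (card I) * \<delta> < 1"
    by (auto simp: \<delta>_def field_simps)
  have "eventually (\<lambda>m. \<forall>i\<in>I. \<forall>j\<in>I. dist (g m i (e j)) (f i (e j)) < \<delta>) F"
    by (intro eventually_ball_finite ballI fin tendstoD lim e(1) \<delta>(1)) 
  then show ?thesis
  proof eventually_elim
    case (elim m)
    show ?case
      unfolding independent_functionals_def
    proof (intro allI impI)
      fix c assume c: "\<forall>p\<in>V. (\<Sum>i\<in>I. c i * g m i p) = 0"
      show "\<forall>i\<in>I. c i = 0"
      proof (cases "I = {}")
        case False
        \<comment> \<open>The equation for the column of a coefficient of maximal modulus forces it to vanish.\<close>
        define M where "M = Max ((\<lambda>i. \<bar>c i\<bar>) ` I)"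
        have "M \<in> (\<lambda>i. \<bar>c i\<bar>) ` I"
          unfolding M_def using fin False by (intro Max_in) auto
        then obtain j where j: "j \<in> I" "\<bar>c j\<bar> = M"
          by blast
        have M: "\<bar>c i\<bar> \<le> M" if "i \<in> I" for i
          unfolding M_def using that fin by (intro Max_ge) auto
        have "(\<Sum>i\<in>I. c i * f i (e j)) = (\<Sum>i\<in>I. if i = j then c i else 0)"
          using e(2) j by (intro sum.cong) auto
        also have "\<dots> = c j" using fin j by simp
        finally have "c j = (\<Sum>i\<in>I. c i * f i (e j)) - (\<Sum>i\<in>I. c i * g m i (e j))"
          using c e(1) j by simp
        also have "\<dots> = (\<Sum>i\<in>I. c i * (f i (e j) - g m i (e j)))"
          by (simp add: sum_subtractf right_diff_distrib)
        finally have "M = \<bar>\<Sum>i\<in>I. c i * (f i (e j) - g m i (e j))\<bar>" using j by simp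
        also have "\<dots> \<le> (\<Sum>i\<in>I. \<bar>c i * (f i (e j) - g m i (e j))\<bar>)" by (rule sum_abs)
        also have "\<dots> \<le> (\<Sum>i\<in>I. M * \<delta>)"
        proof (rule sum_mono)
          fix i assume i: "i \<in> I"
          have "\<bar>f i (e j) - g m i (e j)\<bar> \<le> \<delta>"
            using elim[rule_format, OF i j(1)] by (simp only: dist_real_def abs_minus_commute)
          then show "\<bar>c i * (f i (e j) - g m i (e j))\<bar> \<le> M * \<delta>"
            unfolding abs_mult using M[OF i] by (intro mult_mono) auto
        qed
        also have "\<dots> = M * (real (card I) * \<delta>)" by simp
        finally have "M * (1 - real (card I) * \<delta>) \<le> 0" by (simp add: algebra_simps)
        then have "M \<le> 0" using \<delta>(2) by (simp add: mult_le_0_iff)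
        then show ?thesis using M by fastforce
      qed simp
    qed
  qed
qed

section \<open>Forms, their derivatives and products of linear forms\<close>

text \<open>
  The directional derivative is given by its formula, so that its continuity in the point and the
  direction, its linearity in the form, and the identity of Euler can be read off monomial by
  monomial.
\<close>

definition mpoly_deriv :: "'n::finite mpoly \<Rightarrow> real ^ 'n \<Rightarrow> real ^ 'n \<Rightarrow> real" where
  "mpoly_deriv p x v = (\<Sum>a\<in>Poly_Mapping.keys p. Poly_Mapping.lookup p a *
     (\<Sum>i\<in>UNIV. (real (a $ i) * v $ i * (x $ i) ^ (a $ i - 1)) * (\<Prod>j\<in>UNIV - {i}. (x $ j) ^ (a $ j))))"

lemma lookup_scaleR: "Poly_Mapping.lookup (c *\<^sub>R p) a = c *\<^sub>R Poly_Mapping.lookup p a"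
proof -
  have "finite {a. c *\<^sub>R Poly_Mapping.lookup p a \<noteq> 0}"
    by (rule finite_subset[OF _ finite_keys[of p]]) (auto simp: in_keys_iff)
  then show ?thesis
    by (simp add: scaleR_poly_mapping_def Abs_poly_mapping_inverse)
qed

lemma linear_sum_keys:
  fixes \<phi> :: "'a \<Rightarrow> real"
  shows "linear (\<lambda>p. \<Sum>a\<in>Poly_Mapping.keys p. Poly_Mapping.lookup p a * \<phi> a)"
proof -
  have *: "(\<Sum>a\<in>Poly_Mapping.keys p. Poly_Mapping.lookup p a * \<phi> a) = (\<Sum>a\<in>A. Poly_Mapping.lookup p a * \<phi> a)"
    if "finite A" "Poly_Mapping.keys p \<subseteq> A" for p :: "'a \<Rightarrow>\<^sub>0 real" and A
    using that by (intro sum.mono_neutral_left) (auto simp: in_keys_iff)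
  show ?thesis
  proof (rule linearI)
    fix p q :: "'a \<Rightarrow>\<^sub>0 real"
    let ?A = "Poly_Mapping.keys p \<union> Poly_Mapping.keys q"
    have "finite ?A" "Poly_Mapping.keys (p + q) \<subseteq> ?A" by (simp_all add: keys_add)
    then show "(\<Sum>a\<in>Poly_Mapping.keys (p + q). Poly_Mapping.lookup (p + q) a * \<phi> a) =
       (\<Sum>a\<in>Poly_Mapping.keys p. Poly_Mapping.lookup p a * \<phi> a) +
       (\<Sum>a\<in>Poly_Mapping.keys q. Poly_Mapping.lookup q a * \<phi> a)"
      unfolding *[of ?A "p + q", OF \<open>finite ?A\<close> \<open>Poly_Mapping.keys (p + q) \<subseteq> ?A\<close>]
        *[of ?A p, OF \<open>finite ?A\<close> Un_upper1] *[of ?A q, OF \<open>finite ?A\<close> Un_upper2]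
      by (simp add: lookup_add distrib_right sum.distrib)
  next
    fix c and p :: "'a \<Rightarrow>\<^sub>0 real"
    have "Poly_Mapping.keys (c *\<^sub>R p) \<subseteq> Poly_Mapping.keys p"
      by (auto simp: in_keys_iff lookup_scaleR)
    then show "(\<Sum>a\<in>Poly_Mapping.keys (c *\<^sub>R p). Poly_Mapping.lookup (c *\<^sub>R p) a * \<phi> a) =
       c *\<^sub>R (\<Sum>a\<in>Poly_Mapping.keys p. Poly_Mapping.lookup p a * \<phi> a)"
      by (subst *[of "Poly_Mapping.keys p" "c *\<^sub>R p"])
        (simp_all add: lookup_scaleR sum_distrib_left mult.assoc)
  qed
qed

lemma linear_mpoly_eval: "linear (\<lambda>p. mpoly_eval p x)"
  unfolding mpoly_eval_def by (rule linear_sum_keys)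

lemma linear_mpoly_deriv: "linear (\<lambda>p. mpoly_deriv p x v)"
  unfolding mpoly_deriv_def by (rule linear_sum_keys)

lemma mpoly_eval_single: "mpoly_eval (Poly_Mapping.single a c) x = c * (\<Prod>i\<in>UNIV. (x $ i) ^ (a $ i))"
  by (simp add: mpoly_eval_def)

lemma has_derivative_mpoly_eval:
  fixes x :: "real ^ 'n::finite"
  shows "(mpoly_eval p has_derivative mpoly_deriv p x) (at x)"
proof -
  have "((\<lambda>x. x $ i) has_derivative (\<lambda>v. v $ i)) (at x)" for i :: 'n
    by (rule bounded_linear.has_derivative[OF bounded_linear_vec_nth has_derivative_ident])
  then have "((\<lambda>x. (x $ i) ^ (a $ i)) has_derivative (\<lambda>v. real (a $ i) * v $ i * (x $ i) ^ (a $ i - 1))) (at x)"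
    for i and a :: "nat ^ 'n"
    using has_derivative_power[of "\<lambda>x. x $ i" "\<lambda>v. v $ i" x UNIV "a $ i"] by (simp add: mult.assoc)
  then have "((\<lambda>x. \<Sum>a\<in>Poly_Mapping.keys p. Poly_Mapping.lookup p a * (\<Prod>i\<in>UNIV. (x $ i) ^ (a $ i)))
     has_derivative mpoly_deriv p x) (at x)"
    unfolding mpoly_deriv_def
    by (intro has_derivative_sum has_derivative_mult_right has_derivative_prod)
  then show ?thesis
    by (subst mpoly_eval_def[abs_def])
qed

lemma linear_mpoly_deriv_direction: "linear (mpoly_deriv p x)"
  using has_derivative_mpoly_eval by (rule has_derivative_linear)

lemma tendsto_mpoly_eval:
  assumes "(x \<longlongrightarrow> y) F"
  shows "((\<lambda>m. mpoly_eval p (x m)) \<longlongrightarrow> mpoly_eval p y) F"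
  unfolding mpoly_eval_def by (intro tendsto_intros assms)

lemma tendsto_mpoly_deriv:
  assumes "(x \<longlongrightarrow> y) F" "(v \<longlongrightarrow> w) F"
  shows "((\<lambda>m. mpoly_deriv p (x m) (v m)) \<longlongrightarrow> mpoly_deriv p y w) F"
  unfolding mpoly_deriv_def by (intro tendsto_intros assms)

lemma mpoly_eval_scaleR:
  assumes "p \<in> forms d"
  shows "mpoly_eval p (c *\<^sub>R x) = c ^ d * mpoly_eval p x"
proof -
  have "(\<Prod>i\<in>UNIV. ((c *\<^sub>R x) $ i) ^ (a $ i)) = c ^ d * (\<Prod>i\<in>UNIV. (x $ i) ^ (a $ i))"
    if "a \<in> Poly_Mapping.keys p" for a
  proof -
    have "d = (\<Sum>i\<in>UNIV. a $ i)" using assms that by (simp add: forms_def)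
    then show ?thesis by (simp add: power_mult_distrib prod.distrib power_sum)
  qed
  then show ?thesis by (simp add: mpoly_eval_def sum_distrib_left mult_ac)
qed

text \<open>
  The identity of Euler.
\<close>

lemma mpoly_deriv_self:
  assumes "p \<in> forms d"
  shows "mpoly_deriv p x x = real d * mpoly_eval p x"
proof -
  have "(\<Sum>i\<in>UNIV. (real (a $ i) * x $ i * (x $ i) ^ (a $ i - 1)) * (\<Prod>j\<in>UNIV - {i}. (x $ j) ^ (a $ j)))
      = real d * (\<Prod>i\<in>UNIV. (x $ i) ^ (a $ i))" if "a \<in> Poly_Mapping.keys p" for a
  proof -
    have d: "real d = (\<Sum>i\<in>UNIV. real (a $ i))"
      using assms that by (simp add: forms_def flip: of_nat_sum)
    have "(real (a $ i) * x $ i * (x $ i) ^ (a $ i - 1)) * (\<Prod>j\<in>UNIV - {i}. (x $ j) ^ (a $ j))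
        = real (a $ i) * (\<Prod>i\<in>UNIV. (x $ i) ^ (a $ i))" for i
      by (subst prod.remove[of UNIV i]) (auto simp: power_eq_if)
    then show ?thesis unfolding d sum_distrib_right by (rule sum.cong[OF refl])
  qed
  then show ?thesis by (simp add: mpoly_eval_def mpoly_deriv_def sum_distrib_left mult_ac)
qed

lemma vanishes_to_order_2_iff: "vanishes_to_order_2 p s \<longleftrightarrow> (\<forall>i. mpoly_deriv p s (axis i 1) = 0)"
proof -
  have "((\<lambda>t. mpoly_eval p (s + t *\<^sub>R v)) has_real_derivative mpoly_deriv p s v) (at 0)" for v
  proof -
    have "((\<lambda>t. s + t *\<^sub>R v) has_derivative (\<lambda>t. t *\<^sub>R v)) (at 0)"
      by (auto intro!: derivative_eq_intros)
    moreover have "(mpoly_eval p has_derivative mpoly_deriv p s) (at (s + 0 *\<^sub>R v))"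
      using has_derivative_mpoly_eval by simp
    ultimately have "((\<lambda>t. mpoly_eval p (s + t *\<^sub>R v)) has_derivative (\<lambda>t. mpoly_deriv p s (t *\<^sub>R v))) (at 0)"
      by (rule has_derivative_compose)
    then show ?thesis
      by (rule has_derivative_imp_has_field_derivative)
        (simp add: linear_cmul[OF linear_mpoly_deriv_direction])
  qed
  then show ?thesis
    unfolding vanishes_to_order_2_def by (metis DERIV_unique)
qed

lemma subspace_forms: "subspace (forms d)"
  unfolding subspace_def forms_def
  by (auto simp: lookup_scaleR in_keys_iff lookup_add)

lemma finite_exponents: "finite {a :: nat ^ 'n::finite. (\<Sum>i\<in>UNIV. a $ i) = d}"
proof -
  have "{a :: nat ^ 'n. (\<Sum>i\<in>UNIV. a $ i) = d} \<subseteq> vec_lambda ` (UNIV \<rightarrow>\<^sub>E {..d})"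
  proof
    fix a :: "nat ^ 'n" assume "a \<in> {a. (\<Sum>i\<in>UNIV. a $ i) = d}"
    then have "a $ i \<le> d" for i
      using member_le_sum[of i UNIV "\<lambda>i. a $ i"] by simp
    then show "a \<in> vec_lambda ` (UNIV \<rightarrow>\<^sub>E {..d})"
      by (intro image_eqI[of _ _ "\<lambda>i. a $ i"]) auto
  qed
  then show ?thesis by (rule finite_subset) (intro finite_imageI finite_PiE; simp)
qed

lemma forms_finite_dimensional:
  obtains T :: "'n::finite mpoly set" where "finite T" "forms d \<subseteq> span T"
proof
  let ?T = "(\<lambda>a. Poly_Mapping.single a 1) ` {a :: nat ^ 'n. (\<Sum>i\<in>UNIV. a $ i) = d}"
  show "finite ?T" using finite_exponents by blast
  show "forms d \<subseteq> span ?T"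
  proof
    fix p :: "'n mpoly" assume p: "p \<in> forms d"
    have "p = (\<Sum>a\<in>Poly_Mapping.keys p. Poly_Mapping.lookup p a *\<^sub>R Poly_Mapping.single a 1)"
    proof (rule poly_mapping_eqI)
      fix b
      have "(\<Sum>a\<in>Poly_Mapping.keys p. Poly_Mapping.lookup p a * Poly_Mapping.lookup (Poly_Mapping.single a 1) b)
         = (\<Sum>a\<in>Poly_Mapping.keys p. if a = b then Poly_Mapping.lookup p a else 0)"
        by (intro sum.cong) (auto simp: lookup_single when_def)
      then show "Poly_Mapping.lookup p b = Poly_Mapping.lookup
          (\<Sum>a\<in>Poly_Mapping.keys p. Poly_Mapping.lookup p a *\<^sub>R Poly_Mapping.single a 1) b"
        by (simp add: lookup_sum lookup_scaleR in_keys_iff)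
    qed
    also have "\<dots> \<in> span ?T"
      using p by (intro span_sum span_scale span_base) (auto simp: forms_def)
    finally show "p \<in> span ?T" .
  qed
qed

lemma form_times_coordinate:
  fixes p :: "'n::finite mpoly"
  assumes "p \<in> forms d"
  shows "\<exists>q\<in>forms (Suc d). \<forall>x. mpoly_eval q x = x $ i * mpoly_eval p x"
proof (intro bexI allI)
  let ?s = "\<lambda>a. \<chi> j. if j = i then Suc (a $ j) else a $ j"
  let ?q = "\<Sum>a\<in>Poly_Mapping.keys p. Poly_Mapping.single (?s a) (Poly_Mapping.lookup p a)"
  show "?q \<in> forms (Suc d)"
  proof (intro subspace_sum subspace_forms)
    fix a assume "a \<in> Poly_Mapping.keys p"
    then have "(\<Sum>j\<in>UNIV. a $ j) = d" using assms by (simp add: forms_def)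
    then have "(\<Sum>j\<in>UNIV. ?s a $ j) = Suc d"
      by (simp add: sum.remove[of UNIV i])
    then show "Poly_Mapping.single (?s a) (Poly_Mapping.lookup p a) \<in> forms (Suc d)"
      by (auto simp: forms_def)
  qed
  fix x :: "real ^ 'n"
  have "(\<Prod>j\<in>UNIV. (x $ j) ^ (?s a $ j)) = x $ i * (\<Prod>j\<in>UNIV. (x $ j) ^ (a $ j))" for a
    by (simp add: prod.remove[of UNIV i] mult.assoc)
  then show "mpoly_eval ?q x = x $ i * mpoly_eval p x"
    by (simp add: linear_sum[OF linear_mpoly_eval] mpoly_eval_single)
      (simp add: mpoly_eval_def sum_distrib_left mult_ac)
qed

lemma form_times_linear:
  assumes "p \<in> forms d"
  shows "\<exists>q\<in>forms (Suc d). \<forall>x. mpoly_eval q x = (w \<bullet> x) * mpoly_eval p x"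
proof -
  obtain q where q: "\<And>i. q i \<in> forms (Suc d)" "\<And>i x. mpoly_eval (q i) x = x $ i * mpoly_eval p x"
    using form_times_coordinate[OF assms] by metis
  show ?thesis
  proof (intro bexI allI)
    show "(\<Sum>i\<in>UNIV. (w $ i) *\<^sub>R q i) \<in> forms (Suc d)"
      by (intro subspace_sum subspace_scale subspace_forms q)
    show "mpoly_eval (\<Sum>i\<in>UNIV. (w $ i) *\<^sub>R q i) x = (w \<bullet> x) * mpoly_eval p x" for x
      by (simp add: linear_sum[OF linear_mpoly_eval] linear_cmul[OF linear_mpoly_eval] q
          inner_vec_def sum_distrib_right sum_distrib_left mult_ac)
  qed
qed

lemma form_prod_linear:
  assumes "finite J"
  shows "\<exists>q\<in>forms (card J). \<forall>x. mpoly_eval q x = (\<Prod>j\<in>J. w j \<bullet> x)"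
  using assms
proof (induction J rule: finite_induct)
  case empty
  show ?case
    by (intro bexI[of _ "Poly_Mapping.single 0 1"]) (auto simp: forms_def mpoly_eval_def)
next
  case (insert j J)
  then obtain p where p: "p \<in> forms (card J)" "\<forall>x. mpoly_eval p x = (\<Prod>j\<in>J. w j \<bullet> x)" by blast
  show ?case
    using form_times_linear[OF p(1), of "w j"] insert.hyps p(2) by simp
qed

text \<open>
  At a zero of the linear factor the product rule loses one of its two terms.
\<close>

lemma mpoly_deriv_times_linear:
  assumes q: "\<And>x. mpoly_eval q x = (w \<bullet> x) * mpoly_eval p x" and s: "w \<bullet> s = 0"
  shows "mpoly_deriv q s v = (w \<bullet> v) * mpoly_eval p s"
proof -
  have "((\<lambda>x. (w \<bullet> x) * mpoly_eval p x) has_derivative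
      (\<lambda>v. (w \<bullet> s) * mpoly_deriv p s v + (w \<bullet> v) * mpoly_eval p s)) (at s)"
    by (intro has_derivative_mult has_derivative_mpoly_eval
        bounded_linear.has_derivative[OF bounded_linear_inner_right has_derivative_ident])
  moreover have "mpoly_eval q = (\<lambda>x. (w \<bullet> x) * mpoly_eval p x)" using q by auto
  ultimately have "mpoly_deriv q s = (\<lambda>v. (w \<bullet> s) * mpoly_deriv p s v + (w \<bullet> v) * mpoly_eval p s)"
    using has_derivative_mpoly_eval[of q s] has_derivative_unique by metis
  then show ?thesis using s by simp
qed

section \<open>Independence of a configuration in terms of functionals\<close>

lemma proj_point_eq_iff:
  fixes x y :: "real ^ 'n::finite"
  assumes "x \<noteq> 0" "y \<noteq> 0"
  shows "proj_point x = proj_point y \<longleftrightarrow> (\<exists>t. t \<noteq> 0 \<and> y = t *\<^sub>R x)"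
proof
  assume "proj_point x = proj_point y"
  then have "y \<in> span {x}" unfolding proj_point_def using span_base by blast
  then obtain t where "y = t *\<^sub>R x" by (auto simp: span_singleton)
  then show "\<exists>t. t \<noteq> 0 \<and> y = t *\<^sub>R x" using assms by auto
next
  assume "\<exists>t. t \<noteq> 0 \<and> y = t *\<^sub>R x"
  then obtain t where t: "t \<noteq> 0" "y = t *\<^sub>R x" by blast
  then have "x = (1 / t) *\<^sub>R y" by simp
  then have "x \<in> span {y}" "y \<in> span {x}"
    using t(2) by (metis span_base span_scale singletonI)+
  then show "proj_point x = proj_point y"
    unfolding proj_point_def by (simp add: span_eq)
qed

text \<open>
  The functionals whose common kernel is the space of forms that are doubly vanishing at \<open>y j\<close>.
  They are indexed by the points other than \<open>y j\<close> and by the coordinate directions at \<open>y j\<close>; the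
  value at \<open>y j\<close> itself is, by the identity of Euler, a combination of the latter when
  \<open>d \<ge> 1\<close>. Configurations are families \<open>y\<close> over an index set, because points have to move.
\<close>

definition first_order_functional ::
    "('i \<Rightarrow> real ^ 'n::finite) \<Rightarrow> 'i \<Rightarrow> 'i + 'n \<Rightarrow> 'n mpoly \<Rightarrow> real" where
  "first_order_functional y j k p =
     (case k of Inl i \<Rightarrow> mpoly_eval p (y i) | Inr l \<Rightarrow> mpoly_deriv p (y j) (axis l 1))"

definition first_order_independent :: "nat \<Rightarrow> 'i set \<Rightarrow> ('i \<Rightarrow> real ^ 'n::finite) \<Rightarrow> 'i \<Rightarrow> bool" where
  "first_order_independent d I y j \<longleftrightarrow>
     independent_functionals (forms d) ((I - {j}) <+> UNIV) (first_order_functional y j)"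

lemma linear_first_order_functional: "linear (first_order_functional y j k)"
  unfolding first_order_functional_def
  by (cases k) (simp_all add: linear_mpoly_eval linear_mpoly_deriv)

lemma codim_doubly_vanishing_forms_iff:
  fixes y :: "'i \<Rightarrow> real ^ 'n::finite"
  assumes "finite I" "inj_on y I" "j \<in> I"
  shows "dim (forms d :: 'n mpoly set) =
           dim (doubly_vanishing_forms d (y ` I) (y j)) + (card (y ` I) + CARD('n) - 1)
         \<longleftrightarrow> first_order_independent d I y j"
proof -
  have "y ` I - {y j} = y ` (I - {j})"
    using assms by (auto dest: inj_onD)
  then have "doubly_vanishing_forms d (y ` I) (y j) =
      {p \<in> forms d. \<forall>k\<in>(I - {j}) <+> UNIV. first_order_functional y j k p = 0}"
    unfolding doubly_vanishing_forms_def vanishes_to_order_2_iff first_order_functional_def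
      Plus_def ball_Un by auto
  moreover have "card (y ` I) + CARD('n) - 1 = card ((I - {j}) <+> (UNIV :: 'n set))"
    using card.remove[OF assms(1,3)] assms(1,2)
    by (simp add: card_image card_Plus del: card_Diff_insert card_Diff_singleton)
  moreover obtain T :: "'n mpoly set" where "finite T" "forms d \<subseteq> span T"
    by (rule forms_finite_dimensional)
  ultimately show ?thesis
    unfolding first_order_independent_def using assms(1)
    by (subst independent_functionals_iff_codim[where T = T])
      (simp_all add: subspace_forms linear_first_order_functional)
qed

text \<open>
  Collecting the coefficients of the partial derivatives into one vector \<open>v\<close> replaces them by the
  derivative in the single direction \<open>v\<close>.
\<close>

lemma first_order_independent_iff:
  fixes y :: "'i \<Rightarrow> real ^ 'n::finite"
  assumes "finite I"
  shows "first_order_independent d I y j \<longleftrightarrow>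
    (\<forall>c v. (\<forall>p\<in>forms d. (\<Sum>i\<in>I - {j}. c i * mpoly_eval p (y i)) + mpoly_deriv p (y j) v = 0) \<longrightarrow>
       v = 0 \<and> (\<forall>i\<in>I - {j}. c i = 0))" (is "_ \<longleftrightarrow> ?R")
proof -
  have sum_eq: "(\<Sum>k\<in>(I - {j}) <+> UNIV. b k * first_order_functional y j k p) =
      (\<Sum>i\<in>I - {j}. b (Inl i) * mpoly_eval p (y i)) + mpoly_deriv p (y j) (\<chi> l. b (Inr l))"
    for b and p :: "'n mpoly"
  proof -
    let ?v = "\<chi> l. b (Inr l)"
    have "mpoly_deriv p (y j) ?v = mpoly_deriv p (y j) (\<Sum>l\<in>UNIV. (?v $ l) *\<^sub>R axis l 1)"
      using basis_expansion[of ?v] by (simp add: scalar_mult_eq_scaleR)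
    also have "\<dots> = (\<Sum>l\<in>UNIV. b (Inr l) * mpoly_deriv p (y j) (axis l 1))"
      by (simp add: linear_sum[OF linear_mpoly_deriv_direction] linear_cmul[OF linear_mpoly_deriv_direction])
    finally show ?thesis
      using assms by (simp add: sum.Plus first_order_functional_def)
  qed
  show ?thesis
  proof
    assume L: "first_order_independent d I y j"
    show ?R
    proof (intro allI impI)
      fix c v
      assume rel: "\<forall>p\<in>forms d. (\<Sum>i\<in>I - {j}. c i * mpoly_eval p (y i)) + mpoly_deriv p (y j) v = 0"
      let ?b = "case_sum c (($) v)"
      have "?b k = 0" if "k \<in> (I - {j}) <+> UNIV" for k
        using L[unfolded first_order_independent_def] _ that
        by (rule independent_functionalsD) (use rel in \<open>simp add: sum_eq\<close>)
      from this[of "Inl _"] this[of "Inr _"] show "v = 0 \<and> (\<forall>i\<in>I - {j}. c i = 0)"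
        by (auto simp: vec_eq_iff)
    qed
  next
    assume R: ?R
    show "first_order_independent d I y j"
      unfolding first_order_independent_def independent_functionals_def sum_eq
    proof (intro allI impI ballI)
      fix b and k :: "'i + 'n"
      assume "\<forall>p\<in>forms d. (\<Sum>i\<in>I - {j}. b (Inl i) * mpoly_eval p (y i)) +
          mpoly_deriv p (y j) (\<chi> l. b (Inr l)) = 0"
      then have "(\<chi> l. b (Inr l)) = 0 \<and> (\<forall>i\<in>I - {j}. b (Inl i) = 0)"
        by (intro R[rule_format]) blast
      moreover assume "k \<in> (I - {j}) <+> UNIV"
      ultimately show "b k = 0" by (auto simp: vec_eq_iff)
    qed
  qed
qed

text \<open>
  A relation that involves all values and one derivative at \<open>y j\<close> becomes a relation between
  first-order functionals when the value at \<open>y j\<close> is rewritten as \<open>1 / d\<close> times the derivative in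
  direction \<open>y j\<close>.
\<close>

lemma first_order_independentD:
  fixes y :: "'i \<Rightarrow> real ^ 'n::finite"
  assumes "finite I" "j \<in> I" "d \<ge> 1" and ind: "first_order_independent d I y j"
    and rel: "\<And>p. p \<in> forms d \<Longrightarrow> (\<Sum>i\<in>I. c i * mpoly_eval p (y i)) + mpoly_deriv p (y j) w = 0"
  shows "(c j / real d) *\<^sub>R y j + w = 0" and "\<And>i. i \<in> I \<Longrightarrow> i \<noteq> j \<Longrightarrow> c i = 0"
proof -
  let ?v = "(c j / real d) *\<^sub>R y j + w"
  have "(\<Sum>i\<in>I - {j}. c i * mpoly_eval p (y i)) + mpoly_deriv p (y j) ?v = 0" if p: "p \<in> forms d" for p
  proof -
    have "mpoly_deriv p (y j) ?v = c j * mpoly_eval p (y j) + mpoly_deriv p (y j) w"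
      using \<open>d \<ge> 1\<close> mpoly_deriv_self[OF p, of "y j"]
      by (simp add: linear_add[OF linear_mpoly_deriv_direction] linear_cmul[OF linear_mpoly_deriv_direction])
    then show ?thesis
      using rel[OF p] sum.remove[OF assms(1,2), of "\<lambda>i. c i * mpoly_eval p (y i)"] by simp
  qed
  then have "?v = 0 \<and> (\<forall>i\<in>I - {j}. c i = 0)"
    by (intro ind[unfolded first_order_independent_iff[OF assms(1)], rule_format]) blast
  then show "?v = 0" "\<And>i. i \<in> I \<Longrightarrow> i \<noteq> j \<Longrightarrow> c i = 0" by auto
qed

lemma independent_evaluations:
  fixes y :: "'i \<Rightarrow> real ^ 'n::finite"
  assumes "finite I" "d \<ge> 1" "\<And>j. j \<in> I \<Longrightarrow> y j \<noteq> 0"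
    and "\<And>j. j \<in> I \<Longrightarrow> first_order_independent d I y j"
  shows "independent_functionals (forms d) I (\<lambda>i p. mpoly_eval p (y i))"
  unfolding independent_functionals_def
proof (intro allI impI ballI)
  fix c j
  assume c: "\<forall>p\<in>forms d. (\<Sum>i\<in>I. c i * mpoly_eval p (y i)) = 0" and j: "j \<in> I"
  have "(c j / real d) *\<^sub>R y j + 0 = 0"
    using assms(1) j assms(2) assms(4)[OF j]
    by (rule first_order_independentD) (simp add: c linear_0[OF linear_mpoly_deriv_direction])
  then show "c j = 0" using assms(2) assms(3)[OF j] by simp
qed

lemma evaluation_dual_forms:
  fixes y :: "'i \<Rightarrow> real ^ 'n::finite"
  assumes "finite I" "d \<ge> 1" "\<And>j. j \<in> I \<Longrightarrow> y j \<noteq> 0"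
    and "\<And>j. j \<in> I \<Longrightarrow> first_order_independent d I y j" and "i \<in> I"
  shows "\<exists>p\<in>forms d. \<forall>j\<in>I. mpoly_eval p (y j) = (if j = i then 1 else 0)"
  using independent_functionals_dual[OF subspace_forms assms(1) _ independent_evaluations[OF assms(1-4)]]
    assms(5) linear_mpoly_eval by blast

text \<open>
  If two of the points coincided projectively, homogeneity would tie the values of every form at
  them together, against the existence of dual forms.
\<close>

lemma first_order_independent_imp_inj:
  fixes y :: "'i \<Rightarrow> real ^ 'n::finite"
  assumes "finite I" "d \<ge> 1" "\<And>j. j \<in> I \<Longrightarrow> y j \<noteq> 0"
    and "\<And>j. j \<in> I \<Longrightarrow> first_order_independent d I y j"
  shows "inj_on (\<lambda>i. proj_point (y i)) I"
proof (rule inj_onI, rule ccontr)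
  fix i j assume ij: "i \<in> I" "j \<in> I" "proj_point (y i) = proj_point (y j)" "i \<noteq> j"
  obtain p where p: "p \<in> forms d" "\<forall>k\<in>I. mpoly_eval p (y k) = (if k = j then 1 else 0)"
    using evaluation_dual_forms[OF assms ij(2)] by blast
  obtain t where "y j = t *\<^sub>R y i"
    using ij assms(3) by (auto simp: proj_point_eq_iff)
  then have "mpoly_eval p (y j) = t ^ d * mpoly_eval p (y i)"
    using mpoly_eval_scaleR[OF p(1)] by simp
  then show False using p(2) ij by simp
qed

text \<open>
  The reformulation used from here on. In particular the points are automatically distinct in
  projective space, so only the conditions on the right need to be followed in limits and checked
  for lattice points.
\<close>

lemma d_independent_image_iff:
  fixes y :: "'i \<Rightarrow> real ^ 'n::finite"
  assumes I: "finite I" and d: "d \<ge> 1"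
  shows "inj_on y I \<and> d_independent d (y ` I) \<longleftrightarrow>
    (\<forall>j\<in>I. y j \<noteq> 0 \<and> first_order_independent d I y j) \<and>
    (\<forall>x. x \<noteq> 0 \<longrightarrow> (\<forall>p\<in>forms d. (\<forall>i\<in>I. mpoly_eval p (y i) = 0) \<longrightarrow> mpoly_eval p x = 0) \<longrightarrow>
       (\<exists>i\<in>I. proj_point x = proj_point (y i)))" (is "?L \<longleftrightarrow> ?R")
proof -
  let ?Z = "{x. x \<noteq> 0 \<and> (\<forall>p \<in> vanishing_forms d (y ` I). mpoly_eval p x = 0)}"
  let ?zeros = "\<forall>x. x \<noteq> 0 \<longrightarrow> (\<forall>p\<in>forms d. (\<forall>i\<in>I. mpoly_eval p (y i) = 0) \<longrightarrow> mpoly_eval p x = 0) \<longrightarrow>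
       (\<exists>i\<in>I. proj_point x = proj_point (y i))"
  have Z: "?Z = {x. x \<noteq> 0 \<and> (\<forall>p\<in>forms d. (\<forall>i\<in>I. mpoly_eval p (y i) = 0) \<longrightarrow> mpoly_eval p x = 0)}"
    by (auto simp: vanishing_forms_def)
  have zeros: "proj_point ` ?Z = proj_point ` (y ` I) \<longleftrightarrow> ?zeros" if nz: "\<forall>j\<in>I. y j \<noteq> 0"
  proof
    assume "proj_point ` ?Z = proj_point ` (y ` I)"
    then show ?zeros unfolding Z by blast
  next
    assume z: ?zeros
    have "proj_point ` ?Z \<subseteq> proj_point ` (y ` I)"
      unfolding Z using z by blast
    moreover have "y ` I \<subseteq> ?Z"
      using nz unfolding Z by auto
    ultimately show "proj_point ` ?Z = proj_point ` (y ` I)" by blast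
  qed
  show ?thesis
  proof
    assume ?L
    then have inj: "inj_on y I" and ind: "d_independent d (y ` I)" by blast+
    have nz: "\<forall>j\<in>I. y j \<noteq> 0"
      using ind unfolding d_independent_def by auto
    have "first_order_independent d I y j" if "j \<in> I" for j
      using ind that unfolding codim_doubly_vanishing_forms_iff[OF I inj that, symmetric] d_independent_def
      by simp
    moreover have ?zeros
      using ind unfolding zeros[OF nz, symmetric] d_independent_def by simp
    ultimately show ?R using nz by simp
  next
    assume ?R
    then have nz: "\<forall>j\<in>I. y j \<noteq> 0" and fo: "\<And>j. j \<in> I \<Longrightarrow> first_order_independent d I y j"
      and z: ?zeros by blast+
    have inj: "inj_on (\<lambda>i. proj_point (y i)) I"
      using nz fo by (intro first_order_independent_imp_inj[OF I d]) auto
    have inj_y: "inj_on y I" using inj by (auto simp: inj_on_def)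
    moreover have "d_independent d (y ` I)"
      unfolding d_independent_def
    proof (intro conjI)
      show "finite (y ` I)" using I by simp
      show "0 \<notin> y ` I" using nz by auto
      show "inj_on proj_point (y ` I)" using inj by (auto simp: inj_on_def)
      show "proj_point ` ?Z = proj_point ` (y ` I)" using z zeros[OF nz] by simp
      show "\<forall>s\<in>y ` I. dim (forms d :: 'n mpoly set) = dim (doubly_vanishing_forms d (y ` I) s) +
          (card (y ` I) + CARD('n) - 1)"
        using fo codim_doubly_vanishing_forms_iff[OF I inj_y, of _ d] by (intro ballI) (elim imageE, simp)
    qed
    ultimately show ?L by blast
  qed
qed

section \<open>Limits of additional zeroes\<close>

text \<open>
  Both points move, so differentiability at \<open>s\<close> alone would not suffice. By the mean value theorem
  the quotient is a derivative at an intermediate point, and the derivative is jointly continuous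
  in point and direction.
\<close>

lemma tendsto_difference_quotient:
  fixes a b :: "nat \<Rightarrow> real ^ 'n::finite"
  assumes a: "a \<longlonglongrightarrow> s" and b: "b \<longlonglongrightarrow> s" and ne: "\<And>m. a m \<noteq> b m"
    and v: "(\<lambda>m. (a m - b m) /\<^sub>R norm (a m - b m)) \<longlonglongrightarrow> v"
  shows "(\<lambda>m. (mpoly_eval p (a m) - mpoly_eval p (b m)) / norm (a m - b m)) \<longlonglongrightarrow> mpoly_deriv p s v"
proof -
  have "\<exists>\<theta>. 0 < \<theta> \<and> \<theta> < 1 \<and> mpoly_eval p (a m) - mpoly_eval p (b m) =
      mpoly_deriv p (b m + \<theta> *\<^sub>R (a m - b m)) (a m - b m)" for m
  proof -
    let ?f = "\<lambda>t. mpoly_eval p (b m + t *\<^sub>R (a m - b m))"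
    have "(?f has_derivative (\<lambda>h. mpoly_deriv p (b m + t *\<^sub>R (a m - b m)) (h *\<^sub>R (a m - b m)))) (at t within {0..1})" for t
    proof -
      have "((\<lambda>t. b m + t *\<^sub>R (a m - b m)) has_derivative (\<lambda>h. h *\<^sub>R (a m - b m))) (at t within {0..1})"
        by (auto intro!: derivative_eq_intros)
      then show ?thesis
        by (rule has_derivative_compose[OF _ has_derivative_mpoly_eval])
    qed
    then have "\<exists>\<theta>\<in>{0<..<1}. ?f 1 - ?f 0 =
        mpoly_deriv p (b m + \<theta> *\<^sub>R (a m - b m)) ((1 - 0) *\<^sub>R (a m - b m))"
      by (intro mvt_simple) simp_all
    then show ?thesis by auto
  qed
  \<comment> \<open>The intermediate point depends on \<open>p\<close>, which is harmless since \<open>p\<close> is fixed.\<close>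
  then obtain \<theta> where \<theta>: "\<And>m. 0 < \<theta> m" "\<And>m. \<theta> m < 1"
      "\<And>m. mpoly_eval p (a m) - mpoly_eval p (b m) =
      mpoly_deriv p (b m + \<theta> m *\<^sub>R (a m - b m)) (a m - b m)"
    by metis
  have ab: "(\<lambda>m. a m - b m) \<longlonglongrightarrow> 0" using tendsto_diff[OF a b] by simp
  have "(\<lambda>m. \<theta> m *\<^sub>R (a m - b m)) \<longlonglongrightarrow> 0"
  proof (rule Lim_null_comparison[OF _ tendsto_norm_zero[OF ab]], intro always_eventually allI)
    fix m
    have "\<bar>\<theta> m\<bar> * norm (a m - b m) \<le> 1 * norm (a m - b m)"
      using \<theta>(1,2)[of m] by (intro mult_right_mono) auto
    then show "norm (\<theta> m *\<^sub>R (a m - b m)) \<le> norm (a m - b m)" by simp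
  qed
  then have "(\<lambda>m. b m + \<theta> m *\<^sub>R (a m - b m)) \<longlonglongrightarrow> s"
    using tendsto_add[OF b] by fastforce
  then have "(\<lambda>m. mpoly_deriv p (b m + \<theta> m *\<^sub>R (a m - b m)) ((a m - b m) /\<^sub>R norm (a m - b m)))
      \<longlonglongrightarrow> mpoly_deriv p s v"
    by (rule tendsto_mpoly_deriv[OF _ v])
  moreover have "mpoly_deriv p (b m + \<theta> m *\<^sub>R (a m - b m)) ((a m - b m) /\<^sub>R norm (a m - b m)) =
      (mpoly_eval p (a m) - mpoly_eval p (b m)) / norm (a m - b m)" for m
    by (simp add: linear_cmul[OF linear_mpoly_deriv_direction] \<theta>(3) divide_inverse mult.commute)
  ultimately show ?thesis by simp
qed

text \<open>
  If the values at the \<open>y i\<close> together with one further functional \<open>f\<close> are independent, they remain so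
  nearby, and the vector dual to the further functional is a form that vanishes on the whole moved
  configuration but is not annihilated by \<open>g m\<close>.
\<close>

lemma eventually_separating_form:
  fixes y :: "'i \<Rightarrow> real ^ 'n::finite" and u :: "nat \<Rightarrow> 'i \<Rightarrow> real ^ 'n"
  assumes I: "finite I" and u: "\<And>i. i \<in> I \<Longrightarrow> (\<lambda>m. u m i) \<longlonglongrightarrow> y i"
    and lin: "linear f" "\<And>m. linear (g m)"
    and lim: "\<And>p. p \<in> forms d \<Longrightarrow> (\<lambda>m. g m p) \<longlonglongrightarrow> f p"
    and ind: "\<And>c b. (\<And>p. p \<in> forms d \<Longrightarrow> (\<Sum>i\<in>I. c i * mpoly_eval p (y i)) + b * f p = 0) \<Longrightarrow>
        b = 0 \<and> (\<forall>i\<in>I. c i = 0)"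
  shows "\<forall>\<^sub>F m in sequentially. \<exists>p\<in>forms d. (\<forall>i\<in>I. mpoly_eval p (u m i) = 0) \<and> g m p \<noteq> 0"
proof -
  \<comment> \<open>The index \<open>None\<close> stands for the further functional.\<close>
  define J where "J = insert None (Some ` I)"
  define F where "F z h k p = (case k of None \<Rightarrow> h p | Some i \<Rightarrow> mpoly_eval p (z i))"
    for z :: "'i \<Rightarrow> real ^ 'n" and h :: "'n mpoly \<Rightarrow> real" and k p
  have J: "finite J" using I by (simp add: J_def)
  have lin_F: "linear (F z h k)" if "linear h" for z h k
    unfolding F_def using that by (cases k) (simp_all add: linear_mpoly_eval)
  have "independent_functionals (forms d) J (F y f)"
    unfolding independent_functionals_def
  proof (intro allI impI)
    fix c assume c: "\<forall>p\<in>forms d. (\<Sum>k\<in>J. c k * F y f k p) = 0"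
    have "(\<Sum>k\<in>J. c k * F y f k p) = (\<Sum>i\<in>I. c (Some i) * mpoly_eval p (y i)) + c None * f p" for p
      using I by (simp add: J_def F_def sum.reindex)
    then have "c None = 0 \<and> (\<forall>i\<in>I. c (Some i) = 0)"
      using c by (intro ind) simp
    then show "\<forall>k\<in>J. c k = 0" by (simp add: J_def)
  qed
  then have "\<forall>\<^sub>F m in sequentially. independent_functionals (forms d) J (F (u m) (g m))"
  proof (rule eventually_independent_functionals[OF subspace_forms J lin_F[OF lin(1)]])
    fix k and p :: "'n mpoly" assume k: "k \<in> J" and p: "p \<in> forms d"
    show "(\<lambda>m. F (u m) (g m) k p) \<longlonglongrightarrow> F y f k p"
    proof (cases k)
      case None
      then show ?thesis using lim[OF p] by (simp add: F_def)
    next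
      case (Some i)
      then have "i \<in> I" using k by (auto simp: J_def)
      then show ?thesis using tendsto_mpoly_eval[OF u] Some by (simp add: F_def)
    qed
  qed
  then show ?thesis
  proof eventually_elim
    case (elim m)
    obtain e where e: "\<forall>i\<in>J. e i \<in> forms d \<and> (\<forall>j\<in>J. F (u m) (g m) j (e i) = (if j = i then 1 else 0))"
      using independent_functionals_dual[OF subspace_forms J lin_F[OF lin(2)] elim] by blast
    have N: "None \<in> J" by (simp add: J_def)
    have e1: "F (u m) (g m) j (e None) = (if j = None then 1 else 0)" if "j \<in> J" for j
      using e N that by blast
    show ?case
    proof (intro bexI conjI ballI)
      show "e None \<in> forms d" using e N by blast
      show "g m (e None) \<noteq> 0" using e1[OF N] by (simp add: F_def)
      show "mpoly_eval (e None) (u m i) = 0" if "i \<in> I" for i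
        using e1[of "Some i"] that by (simp add: F_def J_def)
    qed
  qed
qed

text \<open>
  Additional zeroes cannot appear out of nothing. Suppose additional zeroes \<open>x m\<close> of configurations
  \<open>u m\<close> tending to \<open>y\<close> converge to \<open>\<xi>\<close>. If \<open>\<xi>\<close> is not a point of the limit configuration, evaluation at
  \<open>\<xi>\<close> is independent of the evaluations at the \<open>y i\<close>, because the limit configuration has no
  additional zeroes. If \<open>\<xi>\<close> is the point \<open>y j\<close>, then \<open>x m\<close> and \<open>u m j\<close> are distinct zeroes that merge,
  and the difference quotient between them tends to a derivative at \<open>y j\<close> in a direction \<open>v\<close>, which
  is independent of the evaluations by the codimension condition as long as \<open>v\<close> is not a multiple
  of \<open>y j\<close>. Either way some form vanishes on \<open>u m\<close> but not at \<open>x m\<close>.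
\<close>

lemma no_additional_zero_limit:
  fixes y :: "'i \<Rightarrow> real ^ 'n::finite" and u :: "nat \<Rightarrow> 'i \<Rightarrow> real ^ 'n"
  assumes I: "finite I" and d: "d \<ge> 1"
    and y: "inj_on y I" "d_independent d (y ` I)"
    and u: "\<And>i. i \<in> I \<Longrightarrow> (\<lambda>m. u m i) \<longlonglongrightarrow> y i"
    and x: "x \<longlonglongrightarrow> \<xi>" "\<xi> \<noteq> 0"
    and zero: "\<And>m p. p \<in> forms d \<Longrightarrow> (\<And>i. i \<in> I \<Longrightarrow> mpoly_eval p (u m i) = 0) \<Longrightarrow> mpoly_eval p (x m) = 0"
    and nonzero: "\<And>m. x m \<noteq> 0" "\<And>m i. i \<in> I \<Longrightarrow> u m i \<noteq> 0"
    and new: "\<And>m i. i \<in> I \<Longrightarrow> proj_point (x m) \<noteq> proj_point (u m i)"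
  shows False
proof -
  note ind = d_independent_image_iff[OF I d, THEN iffD1, OF conjI[OF y]]
  have ynz: "\<And>i. i \<in> I \<Longrightarrow> y i \<noteq> 0" and fo: "\<And>i. i \<in> I \<Longrightarrow> first_order_independent d I y i"
    using conjunct1[OF ind] by simp_all
  have y1: "\<And>x. x \<noteq> 0 \<Longrightarrow> (\<And>p. p \<in> forms d \<Longrightarrow> (\<And>i. i \<in> I \<Longrightarrow> mpoly_eval p (y i) = 0) \<Longrightarrow> mpoly_eval p x = 0) \<Longrightarrow>
       \<exists>i\<in>I. proj_point x = proj_point (y i)"
    using conjunct2[OF ind] by simp
  show False
  proof (cases "\<exists>i\<in>I. proj_point \<xi> = proj_point (y i)")
    case False
    then obtain q where q: "q \<in> forms d" "\<And>i. i \<in> I \<Longrightarrow> mpoly_eval q (y i) = 0" "mpoly_eval q \<xi> \<noteq> 0"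
      using y1[OF x(2)] by blast
    have "\<forall>\<^sub>F m in sequentially. \<exists>p\<in>forms d. (\<forall>i\<in>I. mpoly_eval p (u m i) = 0) \<and> mpoly_eval p (x m) \<noteq> 0"
    proof (rule eventually_separating_form[OF I u, where f = "\<lambda>p. mpoly_eval p \<xi>"])
      fix c b
      assume rel: "\<And>p. p \<in> forms d \<Longrightarrow> (\<Sum>i\<in>I. c i * mpoly_eval p (y i)) + b * mpoly_eval p \<xi> = 0"
      have "b = 0" using rel[OF q(1)] q(2,3) by simp
      then show "b = 0 \<and> (\<forall>i\<in>I. c i = 0)"
        using independent_functionalsD[OF independent_evaluations[OF I d ynz fo], of c] rel by simp
    qed (simp_all add: linear_mpoly_eval tendsto_mpoly_eval[OF x(1)])
    from eventually_happens'[OF sequentially_bot this]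
    obtain m p where "p \<in> forms d" "\<forall>i\<in>I. mpoly_eval p (u m i) = 0" "mpoly_eval p (x m) \<noteq> 0"
      by blast
    then show False using zero[of p m] by blast
  next
    case True
    then obtain j t where j: "j \<in> I" and t: "t \<noteq> 0" "y j = t *\<^sub>R \<xi>"
      using proj_point_eq_iff[OF x(2) ynz] by blast
    define s where "s = y j"
    have s: "s \<noteq> 0" "s = t *\<^sub>R \<xi>" using ynz[OF j] t by (auto simp: s_def)
    have \<xi>s: "\<xi> \<bullet> s \<noteq> 0" using s x(2) by simp
    have us: "(\<lambda>m. u m j) \<longlonglongrightarrow> s" using u[OF j] by (simp add: s_def)
    \<comment> \<open>Rescaling \<open>x m\<close> to \<open>a m\<close> such that \<open>a m - u m j\<close> is orthogonal to \<open>s\<close> keeps the limit direction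
      orthogonal to \<open>s\<close>, hence transversal to the line of \<open>s\<close>.\<close>
    define \<beta> where "\<beta> m = (u m j \<bullet> s) / (x m \<bullet> s)" for m
    have "\<beta> \<longlonglongrightarrow> (s \<bullet> s) / (\<xi> \<bullet> s)"
      unfolding \<beta>_def by (intro tendsto_intros us x(1) \<xi>s)
    moreover have "(s \<bullet> s) / (\<xi> \<bullet> s) = t"
      using \<xi>s by (subst (1) s(2)) simp
    ultimately have \<beta>: "\<beta> \<longlonglongrightarrow> t" by simp
    define a where "a m = \<beta> m *\<^sub>R x m" for m
    have a: "a \<longlonglongrightarrow> s"
      unfolding a_def s(2) by (intro tendsto_intros \<beta> x(1))
    have "\<forall>\<^sub>F m in sequentially. \<beta> m \<noteq> 0"
      using tendsto_imp_eventually_ne[OF \<beta> t(1)] .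
    moreover have "\<forall>\<^sub>F m in sequentially. x m \<bullet> s \<noteq> 0"
      by (rule tendsto_imp_eventually_ne[OF _ \<xi>s]) (intro tendsto_intros x(1))
    ultimately have "\<forall>\<^sub>F m in sequentially. \<beta> m \<noteq> 0 \<and> x m \<bullet> s \<noteq> 0"
      by (rule eventually_conj)
    then obtain M where M: "\<And>m. \<beta> (m + M) \<noteq> 0 \<and> x (m + M) \<bullet> s \<noteq> 0"
      unfolding eventually_sequentially by (metis le_add2)
    let ?w = "\<lambda>m. a (m + M) - u (m + M) j"
    have w_ne: "a (m + M) \<noteq> u (m + M) j" for m
    proof
      assume "a (m + M) = u (m + M) j"
      then have "\<exists>t. t \<noteq> 0 \<and> u (m + M) j = t *\<^sub>R x (m + M)"
        using M[of m] by (auto simp: a_def)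
      then show False
        using new[OF j] proj_point_eq_iff[OF nonzero(1) nonzero(2)[OF j]] by blast
    qed
    have w_orth: "?w m \<bullet> s = 0" for m
      using M[of m] by (simp add: inner_diff_left a_def \<beta>_def)
    have "?w m /\<^sub>R norm (?w m) \<in> sphere 0 1" for m using w_ne[of m] by simp
    then have "\<forall>m. ?w m /\<^sub>R norm (?w m) \<in> sphere 0 1" ..
    \<comment> \<open>The unit directions converge after passing to a subsequence.\<close>
    from seq_compactE[OF compact_imp_seq_compact[OF compact_sphere] this]
    obtain v r where v: "v \<in> sphere 0 1" and r: "strict_mono r"
      and "((\<lambda>m. ?w m /\<^sub>R norm (?w m)) \<circ> r) \<longlonglongrightarrow> v" .
    note v = v this(3)
    define h where "h m = r m + M" for m
    have h: "filterlim h sequentially sequentially"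
      unfolding h_def using filterlim_subseq[OF r] filterlim_add_const_nat_at_top
      by (rule filterlim_compose[rotated])
    have v_orth: "v \<bullet> s = 0"
    proof (rule LIMSEQ_unique)
      show "(\<lambda>m. ((\<lambda>m. ?w m /\<^sub>R norm (?w m)) \<circ> r) m \<bullet> s) \<longlonglongrightarrow> v \<bullet> s"
        by (intro tendsto_intros v)
      show "(\<lambda>m. ((\<lambda>m. ?w m /\<^sub>R norm (?w m)) \<circ> r) m \<bullet> s) \<longlonglongrightarrow> 0"
        using w_orth by simp
    qed
    let ?g = "\<lambda>m p. (mpoly_eval p (a (h m)) - mpoly_eval p (u (h m) j)) / norm (a (h m) - u (h m) j)"
    have lim_g: "(\<lambda>m. ?g m p) \<longlonglongrightarrow> mpoly_deriv p s v" for p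
    proof (rule tendsto_difference_quotient)
      show "(\<lambda>m. a (h m)) \<longlonglongrightarrow> s" by (rule filterlim_compose[OF a h])
      show "(\<lambda>m. u (h m) j) \<longlonglongrightarrow> s" by (rule filterlim_compose[OF us h])
      show "a (h m) \<noteq> u (h m) j" for m using w_ne by (simp add: h_def)
      show "(\<lambda>m. (a (h m) - u (h m) j) /\<^sub>R norm (a (h m) - u (h m) j)) \<longlonglongrightarrow> v"
        using v(2) by (simp add: h_def o_def)
    qed
    have "\<forall>\<^sub>F m in sequentially. \<exists>p\<in>forms d. (\<forall>i\<in>I. mpoly_eval p (u (h m) i) = 0) \<and> ?g m p \<noteq> 0"
    proof (rule eventually_separating_form[OF I _ linear_mpoly_deriv _ lim_g])
      show "(\<lambda>m. u (h m) i) \<longlonglongrightarrow> y i" if "i \<in> I" for i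
        using filterlim_compose[OF u[OF that] h] .
      show "linear (?g m)" for m
        by (rule linearI)
          (simp_all add: linear_add[OF linear_mpoly_eval] linear_cmul[OF linear_mpoly_eval]
            add_divide_distrib diff_divide_distrib right_diff_distrib)
      fix c b
      assume rel: "\<And>p. p \<in> forms d \<Longrightarrow> (\<Sum>i\<in>I. c i * mpoly_eval p (y i)) + b * mpoly_deriv p s v = 0"
      then have rel': "(\<Sum>i\<in>I. c i * mpoly_eval p (y i)) + mpoly_deriv p (y j) (b *\<^sub>R v) = 0"
        if "p \<in> forms d" for p
        using that by (simp add: linear_cmul[OF linear_mpoly_deriv_direction] s_def)
      have eq: "(c j / real d) *\<^sub>R s + b *\<^sub>R v = 0"
        using first_order_independentD(1)[OF I j d fo[OF j] rel'] by (simp add: s_def)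
      have "((c j / real d) *\<^sub>R s + b *\<^sub>R v) \<bullet> s = (c j / real d) * (s \<bullet> s)"
        using v_orth by (simp add: inner_add_left)
      then have "c j = 0" using eq s d by simp
      moreover have "b = 0" using eq \<open>c j = 0\<close> v(1) by auto
      ultimately show "b = 0 \<and> (\<forall>i\<in>I. c i = 0)"
        using first_order_independentD(2)[OF I j d fo[OF j] rel'] by blast
    qed
    from eventually_happens'[OF sequentially_bot this]
    obtain m p where mp: "p \<in> forms d" "\<And>i. i \<in> I \<Longrightarrow> mpoly_eval p (u (h m) i) = 0" "?g m p \<noteq> 0"
      by blast
    have "mpoly_eval p (a (h m)) \<noteq> 0" using mp(2)[OF j] mp(3) by auto
    then have "mpoly_eval p (x (h m)) \<noteq> 0"
      by (auto simp: a_def mpoly_eval_scaleR[OF mp(1)])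
    then show False using zero[OF mp(1,2)] by blast
  qed
qed

section \<open>Openness in projective space\<close>

text \<open>
  The first-order conditions persist nearby since they are conditions on independence of
  functionals depending continuously on the points. So a sequence of bad configurations tending to
  \<open>y\<close> would eventually have additional zeroes; normalised to unit length, these accumulate on the
  sphere, which \<open>no_additional_zero_limit\<close> excludes.
\<close>

lemma d_independent_nearby:
  fixes y :: "'i \<Rightarrow> real ^ 'n::finite"
  assumes I: "finite I" and d: "d \<ge> 1" and y: "inj_on y I" "d_independent d (y ` I)"
  shows "\<exists>\<epsilon>>0. \<forall>z. (\<forall>i\<in>I. dist (z i) (y i) < \<epsilon>) \<longrightarrow> inj_on z I \<and> d_independent d (z ` I)"
proof (rule ccontr)
  assume contra: "\<not> ?thesis"
  have "\<exists>z. (\<forall>i\<in>I. dist (z i) (y i) < inverse (real (Suc m))) \<and> \<not> (inj_on z I \<and> d_independent d (z ` I))" for m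
  proof -
    have "inverse (real (Suc m)) > 0" by simp
    then show ?thesis using contra by blast
  qed
  then obtain z where z_dist: "\<And>m i. i \<in> I \<Longrightarrow> dist (z m i) (y i) < inverse (real (Suc m))"
    and z_bad: "\<And>m. \<not> (inj_on (z m) I \<and> d_independent d (z m ` I))" by metis
  have z: "(\<lambda>m. z m i) \<longlonglongrightarrow> y i" if "i \<in> I" for i
  proof (rule metric_tendsto_imp_tendsto[OF LIMSEQ_inverse_real_of_nat])
    show "\<forall>\<^sub>F m in sequentially. dist (z m i) (y i) \<le> dist (inverse (real (Suc m))) 0"
      using z_dist[OF that] by (intro always_eventually) (simp add: less_imp_le)
  qed
  note ind = d_independent_image_iff[OF I d, THEN iffD1, OF conjI[OF y]]
  have ynz: "\<And>i. i \<in> I \<Longrightarrow> y i \<noteq> 0" and fo: "\<And>i. i \<in> I \<Longrightarrow> first_order_independent d I y i"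
    using conjunct1[OF ind] by simp_all
  have "\<forall>\<^sub>F m in sequentially. \<forall>i\<in>I. z m i \<noteq> 0 \<and> first_order_independent d I (z m) i"
  proof (intro eventually_ball_finite I ballI eventually_conj)
    fix j assume j: "j \<in> I"
    show "\<forall>\<^sub>F m in sequentially. z m j \<noteq> 0"
      by (rule tendsto_imp_eventually_ne[OF z[OF j] ynz[OF j]])
    show "\<forall>\<^sub>F m in sequentially. first_order_independent d I (z m) j"
      unfolding first_order_independent_def
    proof (rule eventually_independent_functionals[OF subspace_forms _ linear_first_order_functional])
      show "finite ((I - {j}) <+> (UNIV :: 'n set))" using I by simp
      show "independent_functionals (forms d) ((I - {j}) <+> UNIV) (first_order_functional y j)"
        using fo[OF j] by (simp add: first_order_independent_def)
      fix k and p :: "'n mpoly" assume k: "k \<in> (I - {j}) <+> (UNIV :: 'n set)"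
      show "(\<lambda>m. first_order_functional (z m) j k p) \<longlonglongrightarrow> first_order_functional y j k p"
        using k by (auto simp: first_order_functional_def
            intro!: tendsto_mpoly_eval tendsto_mpoly_deriv tendsto_const z j)
    qed
  qed
  then obtain M where M: "\<And>m. \<forall>i\<in>I. z (m + M) i \<noteq> 0 \<and> first_order_independent d I (z (m + M)) i"
    unfolding eventually_sequentially using le_add2 by blast
  define u where "u m = z (m + M)" for m
  have u: "(\<lambda>m. u m i) \<longlonglongrightarrow> y i" if "i \<in> I" for i
    unfolding u_def using LIMSEQ_ignore_initial_segment[OF z[OF that]] .
  have unz: "u m i \<noteq> 0" if "i \<in> I" for m i using M that by (simp add: u_def)
  have "\<exists>x. norm x = 1 \<and> (\<forall>p\<in>forms d. (\<forall>i\<in>I. mpoly_eval p (u m i) = 0) \<longrightarrow> mpoly_eval p x = 0) \<and>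
      (\<forall>i\<in>I. proj_point x \<noteq> proj_point (u m i))" for m
  proof -
    have "\<not> (\<forall>x. x \<noteq> 0 \<longrightarrow> (\<forall>p\<in>forms d. (\<forall>i\<in>I. mpoly_eval p (u m i) = 0) \<longrightarrow> mpoly_eval p x = 0) \<longrightarrow>
       (\<exists>i\<in>I. proj_point x = proj_point (u m i)))"
      using z_bad[of "m + M"] M[of m] unfolding d_independent_image_iff[OF I d] by (simp add: u_def)
    then obtain x where x: "x \<noteq> 0"
        "\<forall>p\<in>forms d. (\<forall>i\<in>I. mpoly_eval p (u m i) = 0) \<longrightarrow> mpoly_eval p x = 0"
        "\<forall>i\<in>I. proj_point x \<noteq> proj_point (u m i)" by blast
    let ?x = "inverse (norm x) *\<^sub>R x"
    have "proj_point x = proj_point ?x"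
      using x(1) by (subst proj_point_eq_iff) auto
    moreover have "mpoly_eval p ?x = 0"
      if "p \<in> forms d" "\<forall>i\<in>I. mpoly_eval p (u m i) = 0" for p
      using x(2) that by (simp add: mpoly_eval_scaleR[OF that(1)])
    moreover have "norm ?x = 1" using x(1) by simp
    ultimately show ?thesis using x(3) by metis
  qed
  then obtain x where x: "\<And>m. norm (x m) = 1"
      "\<And>m p. p \<in> forms d \<Longrightarrow> \<forall>i\<in>I. mpoly_eval p (u m i) = 0 \<Longrightarrow> mpoly_eval p (x m) = 0"
      "\<And>m i. i \<in> I \<Longrightarrow> proj_point (x m) \<noteq> proj_point (u m i)"
    by metis
  have "\<forall>m. x m \<in> sphere 0 1" using x(1) by simp
  from seq_compactE[OF compact_imp_seq_compact[OF compact_sphere] this]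
  obtain \<xi> r where \<xi>: "\<xi> \<in> sphere 0 1" and r: "strict_mono r" and lim: "(x \<circ> r) \<longlonglongrightarrow> \<xi>" .
  show False
  proof (rule no_additional_zero_limit[OF I d y, where u = "u \<circ> r" and x = "x \<circ> r"])
    show "(\<lambda>m. (u \<circ> r) m i) \<longlonglongrightarrow> y i" if "i \<in> I" for i
      using LIMSEQ_subseq_LIMSEQ[OF u[OF that] r] by (simp add: o_def)
    show "(x \<circ> r) \<longlonglongrightarrow> \<xi>" by (rule lim)
    show "\<xi> \<noteq> 0" using \<xi> by auto
    show "(x \<circ> r) m \<noteq> 0" for m using x(1)[of "r m"] by auto
    show "mpoly_eval p ((x \<circ> r) m) = 0"
      if "p \<in> forms d" "\<And>i. i \<in> I \<Longrightarrow> mpoly_eval p ((u \<circ> r) m i) = 0" for m p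
      using x(2)[OF that(1), of "r m"] that(2) by simp
    show "(u \<circ> r) m i \<noteq> 0" if "i \<in> I" for m i using unz[OF that] by simp
    show "proj_point ((x \<circ> r) m) \<noteq> proj_point ((u \<circ> r) m i)" if "i \<in> I" for m i
      using x(3)[OF that] by simp
  qed
qed

text \<open>
  The projection to projective space is open: the saturation of \<open>W\<close> is the union of its scalar
  multiples.
\<close>

lemma openin_proj_point_image:
  fixes W :: "(real ^ 'n::finite) set"
  assumes "open W" "0 \<notin> W"
  shows "openin projective_space (proj_point ` W)"
proof -
  have nz: "w \<noteq> 0" if "w \<in> W" for w using assms(2) that by blast
  have "{x \<in> - {0}. proj_point x \<in> proj_point ` W} = (\<Union>t\<in>- {0}. (\<lambda>x. t *\<^sub>R x) ` W)"
  proof (intro set_eqI iffI)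
    fix x assume "x \<in> {x \<in> - {0}. proj_point x \<in> proj_point ` W}"
    then obtain w where w: "w \<in> W" "proj_point w = proj_point x" "x \<noteq> 0" by auto
    then obtain t where "t \<noteq> 0" "x = t *\<^sub>R w" using proj_point_eq_iff[OF nz] by blast
    then show "x \<in> (\<Union>t\<in>- {0}. (\<lambda>x. t *\<^sub>R x) ` W)" using w(1) by blast
  next
    fix x assume "x \<in> (\<Union>t\<in>- {0}. (\<lambda>x. t *\<^sub>R x) ` W)"
    then obtain t w where "w \<in> W" "t \<noteq> 0" "x = t *\<^sub>R w" by blast
    moreover from this have "x \<noteq> 0" using nz by simp
    ultimately have "proj_point w = proj_point x"
      using proj_point_eq_iff[OF nz] by blast
    then show "x \<in> {x \<in> - {0}. proj_point x \<in> proj_point ` W}"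
      using \<open>w \<in> W\<close> \<open>x \<noteq> 0\<close> by (metis (mono_tags, lifting) Compl_iff image_eqI mem_Collect_eq singletonD)
  qed
  moreover have "open (\<Union>t\<in>- {0}. (\<lambda>x. t *\<^sub>R x) ` W)"
    using assms(1) by (intro open_UN ballI open_scaling) auto
  ultimately have "open {x \<in> - {0}. proj_point x \<in> proj_point ` W}" by metis
  then have "openin (top_of_set (- {0})) {x \<in> - {0}. proj_point x \<in> proj_point ` W}"
    by (rule open_subset[rotated]) blast
  moreover have "proj_point ` W \<subseteq> proj_point ` (- {0})" using nz by blast
  ultimately show ?thesis unfolding openin_projective_space by blast
qed

lemma d_independent_configurations_iff:
  fixes c :: "nat \<Rightarrow> (real ^ 'n::finite) set"
  shows "c \<in> d_independent_configurations d k \<longleftrightarrow> c \<in> extensional {..<k} \<and>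
    (\<exists>y. inj_on y {..<k} \<and> d_independent d (y ` {..<k}) \<and> (\<forall>i<k. c i = proj_point (y i)))"
proof
  assume "c \<in> d_independent_configurations d k"
  then obtain S where c: "c \<in> (\<Pi>\<^sub>E i\<in>{..<k}. topspace projective_space)" "inj_on c {..<k}"
      and S: "d_independent d S" "proj_point ` S = c ` {..<k}"
    by (auto simp: d_independent_configurations_def)
  have "\<forall>i\<in>{..<k}. \<exists>s\<in>S. c i = proj_point s" using S(2) by (metis imageE image_eqI)
  then obtain y where y: "\<And>i. i < k \<Longrightarrow> y i \<in> S" "\<And>i. i < k \<Longrightarrow> c i = proj_point (y i)"
    by (metis lessThan_iff)
  have inj: "inj_on y {..<k}"
    using c(2) y(2) by (auto simp: inj_on_def)
  have "y ` {..<k} = S"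
  proof
    show "y ` {..<k} \<subseteq> S" using y(1) by blast
    show "S \<subseteq> y ` {..<k}"
    proof
      fix s assume s: "s \<in> S"
      then obtain i where i: "i < k" "proj_point s = c i" using S(2) by (metis imageE image_eqI lessThan_iff)
      have "inj_on proj_point S" using S(1) by (simp add: d_independent_def)
      then have "s = y i" using s y[OF i(1)] i(2) by (simp add: inj_on_def)
      then show "s \<in> y ` {..<k}" using i(1) by blast
    qed
  qed
  then show "c \<in> extensional {..<k} \<and>
    (\<exists>y. inj_on y {..<k} \<and> d_independent d (y ` {..<k}) \<and> (\<forall>i<k. c i = proj_point (y i)))"
    using c(1) inj S(1) y(2) by (intro conjI exI[of _ y]) (auto simp: PiE_def)
next
  assume "c \<in> extensional {..<k} \<and>
    (\<exists>y. inj_on y {..<k} \<and> d_independent d (y ` {..<k}) \<and> (\<forall>i<k. c i = proj_point (y i)))"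
  then obtain y where c: "c \<in> extensional {..<k}" and y: "inj_on y {..<k}" "d_independent d (y ` {..<k})"
      "\<And>i. i < k \<Longrightarrow> c i = proj_point (y i)" by blast
  have "0 \<notin> y ` {..<k}" "inj_on proj_point (y ` {..<k})"
    using y(2) by (simp_all add: d_independent_def)
  show "c \<in> d_independent_configurations d k"
    unfolding d_independent_configurations_def
  proof (intro CollectI conjI exI)
    show "c \<in> topspace (product_topology (\<lambda>_. projective_space) {..<k})"
      using c y(3) \<open>0 \<notin> y ` {..<k}\<close> by (force simp: PiE_def topspace_projective_space)
    show "inj_on c {..<k}"
      using comp_inj_on[OF y(1) \<open>inj_on proj_point (y ` {..<k})\<close>] y(3) by (simp add: inj_on_def)
    show "d_independent d (y ` {..<k})" by (rule y)
    show "proj_point ` y ` {..<k} = c ` {..<k}"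
      unfolding image_image by (rule image_cong) (simp_all add: y(3))
  qed
qed

text \<open>
  Small balls around representatives of the points project to open sets, and every configuration
  with points in these open sets has representatives in the balls.
\<close>

lemma openin_d_independent_configurations:
  assumes d: "d \<ge> 1"
  shows "openin (product_topology (\<lambda>_. projective_space) {..<k})
     (d_independent_configurations d k :: (nat \<Rightarrow> (real ^ 'n::finite) set) set)"
  unfolding openin_product_topology_alt
proof
  fix c :: "nat \<Rightarrow> (real ^ 'n) set" assume "c \<in> d_independent_configurations d k"
  then obtain y where c: "c \<in> extensional {..<k}" and y: "inj_on y {..<k}" "d_independent d (y ` {..<k})"
      "\<And>i. i < k \<Longrightarrow> c i = proj_point (y i)" unfolding d_independent_configurations_iff by blast
  obtain \<epsilon> where \<epsilon>: "\<epsilon> > 0" "\<And>z. (\<forall>i\<in>{..<k}. dist (z i) (y i) < \<epsilon>) \<Longrightarrow>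
      inj_on z {..<k} \<and> d_independent d (z ` {..<k})"
    using d_independent_nearby[OF finite_lessThan d y(1,2)] by blast
  define U where "U i = proj_point ` (ball (y i) \<epsilon> - {0})" for i
  have "openin projective_space (U i)" for i
    unfolding U_def by (intro openin_proj_point_image open_Diff) auto
  moreover have "c \<in> Pi\<^sub>E {..<k} U"
  proof -
    have "y i \<noteq> 0" if "i < k" for i using y(2) that by (force simp: d_independent_def)
    then show ?thesis using c y(3) \<epsilon>(1) by (auto simp: PiE_def U_def)
  qed
  moreover have "Pi\<^sub>E {..<k} U \<subseteq> d_independent_configurations d k"
  proof
    fix b assume b: "b \<in> Pi\<^sub>E {..<k} U"
    then have "\<forall>i\<in>{..<k}. \<exists>z\<in>ball (y i) \<epsilon>. b i = proj_point z"
      by (force simp: U_def PiE_def)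
    then obtain z where z: "\<And>i. i < k \<Longrightarrow> z i \<in> ball (y i) \<epsilon>" "\<And>i. i < k \<Longrightarrow> b i = proj_point (z i)"
      by (metis lessThan_iff)
    then have "inj_on z {..<k} \<and> d_independent d (z ` {..<k})"
      by (intro \<epsilon>(2)) (simp add: dist_commute)
    then show "b \<in> d_independent_configurations d k"
      unfolding d_independent_configurations_iff using b z(2) by (auto simp: PiE_def)
  qed
  ultimately show "\<exists>U. finite {i \<in> {..<k}. U i \<noteq> topspace projective_space} \<and>
      (\<forall>i\<in>{..<k}. openin projective_space (U i)) \<and> c \<in> Pi\<^sub>E {..<k} U \<and>
      Pi\<^sub>E {..<k} U \<subseteq> d_independent_configurations d k"
    by (intro exI[of _ U]) simp
qed

section \<open>Lattice points\<close>

text \<open>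
  On the hyperplane where the coordinates sum to \<open>d\<close>, the linear form \<open>level d i k\<close> vanishes exactly
  where the \<open>i\<close>-th coordinate is \<open>k\<close>.
\<close>

definition level :: "nat \<Rightarrow> 'n::finite \<Rightarrow> nat \<Rightarrow> real ^ 'n" where
  "level d i k = real d *\<^sub>R axis i 1 - real k *\<^sub>R (\<chi> l. 1)"

lemma inner_level: "level d i k \<bullet> x = real d * x $ i - real k * (\<Sum>l\<in>UNIV. x $ l)"
  by (simp add: level_def inner_diff_left inner_axis' inner_vec_def[of "\<chi> l. 1"])

lemma lattice_setE:
  fixes s :: "real ^ 'n::finite"
  assumes "s \<in> lattice_set d"
  obtains a :: "'n \<Rightarrow> nat" where "\<And>i. s $ i = real (a i)" "(\<Sum>i\<in>UNIV. a i) = d" "\<And>i. a i < d"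
    "(\<Sum>i\<in>UNIV. s $ i) = real d"
proof -
  have "\<exists>n. s $ i = real n" for i
  proof -
    have "s $ i \<in> \<int>" "s $ i \<ge> 0" using assms by (auto simp: lattice_set_def)
    then obtain z where z: "s $ i = of_int z" "z \<ge> 0" by (auto elim: Ints_cases)
    then show ?thesis by (intro exI[of _ "nat z"]) simp
  qed
  then obtain a where a: "\<And>i. s $ i = real (a i)" by metis
  have s: "(\<Sum>i\<in>UNIV. s $ i) = real d" using assms by (simp add: lattice_set_def)
  then have sum: "(\<Sum>i\<in>UNIV. a i) = d" by (simp add: a flip: of_nat_sum)
  have "a i < d" for i
  proof -
    have "card {i. s $ i \<noteq> 0} \<ge> 2" using assms by (simp add: lattice_set_def)
    then have "\<not> {i. s $ i \<noteq> 0} \<subseteq> {i}" using card_mono[of "{i}" "{i. s $ i \<noteq> 0}"] by auto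
    then obtain j where j: "j \<noteq> i" "a j \<noteq> 0" by (auto simp: a)
    have "(\<Sum>i\<in>{i, j}. a i) \<le> (\<Sum>i\<in>UNIV. a i)" by (rule sum_mono2) auto
    then show ?thesis using j sum by simp
  qed
  then show ?thesis using that a sum s by blast
qed

lemma lattice_setI:
  fixes a :: "'n::finite \<Rightarrow> nat"
  assumes "\<And>i. s $ i = real (a i)" "(\<Sum>i\<in>UNIV. a i) = d" "\<And>i. a i < d"
  shows "s \<in> lattice_set d"
proof -
  have "\<not> card {i. a i \<noteq> 0} \<le> 1"
  proof
    assume "card {i. a i \<noteq> 0} \<le> 1"
    then have "card {i. a i \<noteq> 0} = 0 \<or> card {i. a i \<noteq> 0} = 1" by linarith
    then have "\<exists>j. {i. a i \<noteq> 0} \<subseteq> {j}" by (auto simp: card_1_singleton_iff)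
    then obtain j where j: "{i. a i \<noteq> 0} \<subseteq> {j}" by blast
    then have "(\<Sum>i\<in>UNIV. a i) = (\<Sum>i\<in>{j}. a i)" by (intro sum.mono_neutral_right) auto
    then show False using assms(2) assms(3)[of j] by simp
  qed
  moreover have "(\<Sum>i\<in>UNIV. s $ i) = real d" using assms(1,2) by (simp flip: of_nat_sum)
  ultimately show ?thesis using assms(1) by (simp add: lattice_set_def)
qed

lemma coordinate_form:
  fixes i :: "'n::finite"
  obtains q where "q \<in> forms d" "\<And>x. mpoly_eval q x = (\<Prod>k<d. level d i k \<bullet> x)"
  using form_prod_linear[of "{..<d}" "level d i"] by auto

text \<open>
  The form \<open>\<Prod>k<d. level d i k\<close> vanishes at every lattice point, as its \<open>i\<close>-th coordinate is less
  than \<open>d\<close>. Exactly one factor vanishes at \<open>s\<close>, so the gradient at \<open>s\<close> is a nonzero multiple of that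
  factor. Taken over all \<open>i\<close> these gradients annihilate only the multiples of \<open>s\<close>.
\<close>

lemma coordinate_form_lattice:
  fixes s :: "real ^ 'n::finite"
  assumes q: "\<And>x. mpoly_eval q x = (\<Prod>k<d. level d i k \<bullet> x)" and s: "s \<in> lattice_set d"
  shows "mpoly_eval q s = 0"
    and "mpoly_deriv q s v = 0 \<Longrightarrow> real d * v $ i = s $ i * (\<Sum>l\<in>UNIV. v $ l)"
proof -
  obtain a where a: "\<And>i. s $ i = real (a i)" "(\<Sum>i\<in>UNIV. a i) = d" "\<And>i. a i < d"
      "(\<Sum>i\<in>UNIV. s $ i) = real d"
    using s by (rule lattice_setE) blast
  have level: "level d i k \<bullet> s = real d * (real (a i) - real k)" for k
    by (simp add: inner_level a(1,4) a(4)[unfolded a(1)] algebra_simps)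
  obtain p where p: "\<And>x. mpoly_eval p x = (\<Prod>k\<in>{..<d} - {a i}. level d i k \<bullet> x)"
    using form_prod_linear[of "{..<d} - {a i}" "level d i"] by auto
  have q_eq: "mpoly_eval q x = (level d i (a i) \<bullet> x) * mpoly_eval p x" for x
    unfolding q p using a(3)[of i] by (intro prod.remove) auto
  show "mpoly_eval q s = 0" unfolding q_eq by (simp add: level)
  have "d > 0" using a(3)[of i] by simp
  then have "mpoly_eval p s \<noteq> 0" unfolding p by (simp add: level)
  moreover have "mpoly_deriv q s v = (level d i (a i) \<bullet> v) * mpoly_eval p s"
    using q_eq by (rule mpoly_deriv_times_linear) (simp add: level)
  ultimately show "real d * v $ i = s $ i * (\<Sum>l\<in>UNIV. v $ l)" if "mpoly_deriv q s v = 0"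
    using that by (simp add: inner_level a(1))
qed

text \<open>
  The Lagrange form \<open>\<Prod>i. \<Prod>k<a i. level d i k\<close> has degree \<open>\<Sum>i. a i = d\<close>. It vanishes at a
  point with exponents \<open>b\<close> as soon as some \<open>b i < a i\<close>, and this happens for every \<open>b\<close> other than \<open>a\<close>
  with the same sum.
\<close>

lemma lagrange_form:
  fixes s :: "real ^ 'n::finite"
  assumes s: "s \<in> lattice_set d"
  obtains q where "q \<in> forms d" "mpoly_eval q s \<noteq> 0"
    "\<And>t. t \<in> lattice_set d \<Longrightarrow> t \<noteq> s \<Longrightarrow> mpoly_eval q t = 0"
proof -
  obtain a where a: "\<And>i. s $ i = real (a i)" "(\<Sum>i\<in>UNIV. a i) = d" "\<And>i. a i < d"
      "(\<Sum>i\<in>UNIV. s $ i) = real d"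
    using s by (rule lattice_setE) blast
  let ?J = "SIGMA i:UNIV. {..<a i}"
  have "card ?J = d" using a(2) by simp
  then obtain q where q: "q \<in> forms d" "\<And>x. mpoly_eval q x = (\<Prod>(i, k)\<in>?J. level d i k \<bullet> x)"
    using form_prod_linear[of ?J "\<lambda>(i, k). level d i k"] by (auto simp: case_prod_unfold)
  show ?thesis
  proof
    show "q \<in> forms d" by (rule q)
    have "level d i k \<bullet> s \<noteq> 0" if "k < a i" for i k
      using that a(3)[of i] by (simp add: inner_level a(1,4) a(4)[unfolded a(1)])
    then show "mpoly_eval q s \<noteq> 0" unfolding q(2) by (auto simp: prod_zero_iff)
    fix t assume t: "t \<in> lattice_set d" "t \<noteq> s"
    obtain b where b: "\<And>i. t $ i = real (b i)" "(\<Sum>i\<in>UNIV. b i) = d" "\<And>i. b i < d"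
        "(\<Sum>i\<in>UNIV. t $ i) = real d"
      using t(1) by (rule lattice_setE) blast
    have "\<exists>i. b i < a i"
    proof (rule ccontr)
      assume "\<not> ?thesis"
      then have le: "\<And>i. a i \<le> b i" by (simp add: not_less)
      obtain j where "a j \<noteq> b j" using t(2) unfolding vec_eq_iff a(1) b(1) by fastforce
      then have "(\<Sum>i\<in>UNIV. a i) < (\<Sum>i\<in>UNIV. b i)"
        using le by (intro sum_strict_mono_ex1) (auto simp: le_less)
      then show False using a(2) b(2) by simp
    qed
    then obtain i where "b i < a i" ..
    moreover have "level d i (b i) \<bullet> t = 0"
      unfolding inner_level b(4) by (simp add: b(1))
    ultimately show "mpoly_eval q t = 0" unfolding q(2) by (intro prod_zero) (auto intro!: bexI[of _ "(i, b i)"])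
  qed
qed

lemma finite_lattice_set: "finite (lattice_set d :: (real ^ 'n::finite) set)"
proof (rule finite_subset)
  show "lattice_set d \<subseteq> (\<lambda>a. \<chi> i. real (a $ i)) ` {a :: nat ^ 'n. (\<Sum>i\<in>UNIV. a $ i) = d}"
  proof
    fix s :: "real ^ 'n" assume "s \<in> lattice_set d"
    then obtain a where "\<And>i. s $ i = real (a i)" "(\<Sum>i\<in>UNIV. a i) = d" by (rule lattice_setE) blast
    then show "s \<in> (\<lambda>a. \<chi> i. real (a $ i)) ` {a :: nat ^ 'n. (\<Sum>i\<in>UNIV. a $ i) = d}"
      by (intro image_eqI[of _ _ "\<chi> i. a i"]) (auto simp: vec_eq_iff)
  qed
  show "finite ((\<lambda>a. \<chi> i. real (a $ i)) ` {a :: nat ^ 'n. (\<Sum>i\<in>UNIV. a $ i) = d})"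
    using finite_exponents by (rule finite_imageI)
qed

text \<open>
  The common zeroes of the coordinate forms. A nonzero \<open>x\<close> with coordinate sum zero would have all
  coordinates zero, so \<open>x\<close> can be rescaled to coordinate sum \<open>d\<close>, and then its coordinates are
  integers between \<open>0\<close> and \<open>d - 1\<close>.
\<close>

lemma coordinate_forms_zero:
  fixes x :: "real ^ 'n::finite"
  assumes d: "d \<ge> 1" and x: "x \<noteq> 0" and zero: "\<And>i. \<exists>k<d. level d i k \<bullet> x = 0"
  shows "\<exists>s t. s \<in> lattice_set d \<and> t \<noteq> 0 \<and> x = t *\<^sub>R s"
proof -
  let ?\<sigma> = "\<Sum>l\<in>UNIV. x $ l"
  obtain k where k: "\<And>i. k i < d" "\<And>i. real d * x $ i = real (k i) * ?\<sigma>"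
    using zero unfolding inner_level by (metis eq_iff_diff_eq_0)
  have "?\<sigma> \<noteq> 0"
  proof
    assume "?\<sigma> = 0"
    then have "x = 0" using k(2) d by (simp add: vec_eq_iff)
    then show False using x by simp
  qed
  have "real d * ?\<sigma> = (\<Sum>i\<in>UNIV. real (k i)) * ?\<sigma>"
    unfolding sum_distrib_left[of "real d"] sum_distrib_right k(2) by simp
  then have "real d = real (\<Sum>i\<in>UNIV. k i)" using \<open>?\<sigma> \<noteq> 0\<close> by simp
  then have "(\<Sum>i\<in>UNIV. k i) = d" by (metis of_nat_eq_iff)
  then have "(\<chi> i. real (k i)) \<in> lattice_set d" by (intro lattice_setI[of _ k] k) auto
  moreover have "x = (?\<sigma> / real d) *\<^sub>R (\<chi> i. real (k i))"
    using k(2) d by (simp add: vec_eq_iff field_simps)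
  moreover have "?\<sigma> / real d \<noteq> 0" using \<open>?\<sigma> \<noteq> 0\<close> d by simp
  ultimately show ?thesis by blast
qed

text \<open>
  Subsets are included because they provide configurations of every size. The coordinate forms
  leave only lattice points as possible common zeroes and the Lagrange forms remove those outside
  \<open>S\<close>. In a relation between first-order functionals at \<open>s\<close>, the coordinate forms make the
  direction \<open>v\<close> a multiple of \<open>s\<close>, the Lagrange form of \<open>t\<close> then isolates the coefficient of \<open>t\<close>, and
  that of \<open>s\<close> isolates the remaining multiple.
\<close>

lemma d_independent_subset_lattice_set:
  fixes S :: "(real ^ 'n::finite) set"
  assumes d: "d \<ge> 1" and S: "S \<subseteq> lattice_set d"
  shows "d_independent d S"
proof -
  have fin: "finite S" using S finite_lattice_set by (rule finite_subset)
  have nz: "s \<noteq> 0" if "s \<in> lattice_set d" for s :: "real ^ 'n"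
    using that d by (auto simp: lattice_set_def)
  have fo: "first_order_independent d S id s" if s: "s \<in> S" for s
    unfolding first_order_independent_iff[OF fin] id_apply
  proof (intro allI impI)
    fix c and v :: "real ^ 'n"
    assume rel: "\<forall>p\<in>forms d. (\<Sum>t\<in>S - {s}. c t * mpoly_eval p t) + mpoly_deriv p s v = 0"
    let ?\<sigma> = "\<Sum>l\<in>UNIV. v $ l"
    have sL: "s \<in> lattice_set d" using s S by blast
    have "real d * v $ i = s $ i * ?\<sigma>" for i
    proof -
      obtain q where q: "q \<in> forms d" "\<And>x. mpoly_eval q x = (\<Prod>k<d. level d i k \<bullet> x)"
        by (rule coordinate_form) blast
      have "(\<Sum>t\<in>S - {s}. c t * mpoly_eval q t) = 0"
        using S by (intro sum.neutral) (auto simp: coordinate_form_lattice(1)[OF q(2)])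
      then have "mpoly_deriv q s v = 0" using bspec[OF rel q(1)] by simp
      then show ?thesis by (rule coordinate_form_lattice(2)[OF q(2) sL])
    qed
    then have v: "v = (?\<sigma> / real d) *\<^sub>R s" using d by (simp add: vec_eq_iff field_simps)
    have deriv_v: "mpoly_deriv p s v = ?\<sigma> * mpoly_eval p s" if "p \<in> forms d" for p
      using d mpoly_deriv_self[OF that, of s]
      by (subst v) (simp add: linear_cmul[OF linear_mpoly_deriv_direction])
    have "c t = 0" if t: "t \<in> S - {s}" for t
    proof -
      obtain q where q: "q \<in> forms d" "mpoly_eval q t \<noteq> 0"
          "\<And>u. u \<in> lattice_set d \<Longrightarrow> u \<noteq> t \<Longrightarrow> mpoly_eval q u = 0"
        using t S by (auto intro: lagrange_form[of t d])
      have "(\<Sum>u\<in>S - {s}. c u * mpoly_eval q u) = (\<Sum>u\<in>{t}. c u * mpoly_eval q u)"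
        using fin t q(3) S by (intro sum.mono_neutral_right) auto
      moreover have "mpoly_deriv q s v = 0" using deriv_v[OF q(1)] q(3)[OF sL] t by auto
      ultimately show ?thesis using bspec[OF rel q(1)] q(2) by simp
    qed
    moreover have "v = 0"
    proof -
      obtain q where q: "q \<in> forms d" "mpoly_eval q s \<noteq> 0"
          "\<And>u. u \<in> lattice_set d \<Longrightarrow> u \<noteq> s \<Longrightarrow> mpoly_eval q u = 0"
        using lagrange_form[OF sL] by blast
      have "(\<Sum>u\<in>S - {s}. c u * mpoly_eval q u) = 0"
        using q(3) S by (intro sum.neutral) auto
      then have "?\<sigma> = 0" using bspec[OF rel q(1)] deriv_v[OF q(1)] q(2) by simp
      then show ?thesis using v by simp
    qed
    ultimately show "v = 0 \<and> (\<forall>t\<in>S - {s}. c t = 0)" by blast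
  qed
  have zeros: "\<exists>s\<in>S. proj_point x = proj_point s"
    if x: "x \<noteq> 0" "\<forall>p\<in>forms d. (\<forall>s\<in>S. mpoly_eval p s = 0) \<longrightarrow> mpoly_eval p x = 0" for x
  proof -
    have "\<exists>k<d. level d i k \<bullet> x = 0" for i
    proof -
      obtain q where q: "q \<in> forms d" "\<And>x. mpoly_eval q x = (\<Prod>k<d. level d i k \<bullet> x)"
        by (rule coordinate_form) blast
      have "\<forall>s\<in>S. mpoly_eval q s = 0" using S coordinate_form_lattice(1)[OF q(2)] by blast
      then have "mpoly_eval q x = 0" using x(2) q(1) by blast
      then show ?thesis unfolding q(2) by (auto simp: prod_zero_iff)
    qed
    then obtain s t where s: "s \<in> lattice_set d" "t \<noteq> 0" "x = t *\<^sub>R s"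
      using coordinate_forms_zero[OF d x(1)] by blast
    obtain q where q: "q \<in> forms d" "mpoly_eval q s \<noteq> 0"
        "\<And>u. u \<in> lattice_set d \<Longrightarrow> u \<noteq> s \<Longrightarrow> mpoly_eval q u = 0"
      using lagrange_form[OF s(1)] by blast
    have "s \<in> S"
    proof (rule ccontr)
      assume "s \<notin> S"
      then have "\<forall>u\<in>S. mpoly_eval q u = 0" using q(3) S by blast
      then have "mpoly_eval q x = 0" using x(2) q(1) by blast
      then show False using q(2) s(2,3) by (simp add: mpoly_eval_scaleR[OF q(1)])
    qed
    moreover have "proj_point s = proj_point x"
      using proj_point_eq_iff[OF nz[OF s(1)] x(1)] s by blast
    ultimately show ?thesis by metis
  qed
  have "inj_on id S \<and> d_independent d (id ` S)"
    unfolding d_independent_image_iff[OF fin d] using fo nz S zeros by auto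
  then show ?thesis by simp
qed

text \<open>
  Lattice points are the multiplicity vectors of multisets of \<open>d\<close> variables; the excluded vertices of
  the simplex are the multisets in which a single variable is repeated \<open>d\<close> times.
\<close>

lemma lattice_set_eq_multisets:
  assumes d: "d \<ge> 1"
  shows "(lattice_set d :: (real ^ 'n::finite) set) =
    (\<lambda>M. \<chi> i. real (count M i)) ` (multisets_of_size UNIV d - range (replicate_mset d))"
proof (intro set_eqI iffI)
  fix s :: "real ^ 'n" assume "s \<in> lattice_set d"
  then obtain a where a: "\<And>i. s $ i = real (a i)" "(\<Sum>i\<in>UNIV. a i) = d" "\<And>i. a i < d"
    by (rule lattice_setE) blast
  let ?M = "\<Sum>i\<in>UNIV. replicate_mset (a i) i"
  have M: "count ?M i = a i" for i by (simp add: count_sum)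
  have "size ?M = d" using a(2) by simp
  moreover have "?M \<noteq> replicate_mset d i" for i
    using M[of i] a(3)[of i] by auto
  ultimately show "s \<in> (\<lambda>M. \<chi> i. real (count M i)) ` (multisets_of_size UNIV d - range (replicate_mset d))"
    using a(1) M by (intro image_eqI[of _ _ ?M]) (auto simp: vec_eq_iff multisets_of_size_def)
next
  fix s :: "real ^ 'n"
  assume "s \<in> (\<lambda>M. \<chi> i. real (count M i)) ` (multisets_of_size UNIV d - range (replicate_mset d))"
  then obtain M :: "'n multiset" where M: "s = (\<chi> i. real (count M i))" "size M = d" "\<And>i. M \<noteq> replicate_mset d i"
    by (auto simp: multisets_of_size_def)
  have "count M i < d" for i
  proof -
    have "count M i \<noteq> d"
    proof
      assume "count M i = d"
      then have "replicate_mset d i \<subseteq># M" by (simp add: count_le_replicate_mset_subset_eq[symmetric])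
      then have "M = replicate_mset d i" using M(2)
        by (metis mset_subset_size nless_le size_replicate_mset subset_mset.le_less)
      then show False using M(3) by blast
    qed
    then show ?thesis using count_le_size[of M i] M(2) by simp
  qed
  moreover have "(\<Sum>i\<in>UNIV. count M i) = d"
    using M(2) unfolding size_multiset_overloaded_eq
    by (subst sum.mono_neutral_right[of UNIV "set_mset M"]) (auto simp: not_in_iff)
  ultimately show "s \<in> lattice_set d" by (intro lattice_setI[of _ "count M"]) (simp_all add: M(1))
qed

lemma card_lattice_set:
  assumes d: "d \<ge> 1"
  shows "card (lattice_set d :: (real ^ 'n::finite) set) = ((CARD('n) + d - 1) choose d) - CARD('n)"
proof -
  have "inj (\<lambda>M :: 'n multiset. \<chi> i. real (count M i))"
    by (auto simp: inj_def vec_eq_iff multiset_eq_iff)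
  then have "card (lattice_set d :: (real ^ 'n) set) =
      card (multisets_of_size (UNIV :: 'n set) d - range (replicate_mset d))"
    unfolding lattice_set_eq_multisets[OF d] by (intro card_image) (rule inj_on_subset, auto)
  also have "\<dots> = card (multisets_of_size (UNIV :: 'n set) d) - card (range (replicate_mset d :: 'n \<Rightarrow> _))"
    by (rule card_Diff_subset) (auto simp: multisets_of_size_def)
  also have "card (range (replicate_mset d :: 'n \<Rightarrow> _)) = CARD('n)"
  proof (rule card_image)
    show "inj (replicate_mset d :: 'n \<Rightarrow> _)"
    proof (rule injI)
      fix i j :: 'n assume "replicate_mset d i = replicate_mset d j"
      then have "count (replicate_mset d i) i = count (replicate_mset d j) i" by simp
      then show "i = j" using d by (simp split: if_splits)
    qed
  qed
  finally show ?thesis by (simp add: card_multisets_of_size)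
qed

theorem mainTheorem3:
  fixes d :: nat
  assumes "d \<ge> 1"
  shows "finite (lattice_set d :: (real ^ 'n::finite) set)
       \<and> card (lattice_set d :: (real ^ 'n) set) = ((CARD('n) + d - 1) choose d) - CARD('n)
       \<and> d_independent d (lattice_set d :: (real ^ 'n) set)
       \<and> (\<forall>k. 1 \<le> k \<and> k \<le> ((CARD('n) + d - 1) choose d) - CARD('n) \<longrightarrow>
            (d_independent_configurations d k :: (nat \<Rightarrow> (real ^ 'n) set) set) \<noteq> {} \<and>
            openin (product_topology (\<lambda>_. projective_space) {..<k})
              (d_independent_configurations d k :: (nat \<Rightarrow> (real ^ 'n) set) set))"
proof (intro conjI allI impI)
  show "finite (lattice_set d :: (real ^ 'n) set)" by (rule finite_lattice_set)
  show card: "card (lattice_set d :: (real ^ 'n) set) = ((CARD('n) + d - 1) choose d) - CARD('n)"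
    using assms by (rule card_lattice_set)
  show "d_independent d (lattice_set d :: (real ^ 'n) set)"
    using assms by (rule d_independent_subset_lattice_set) simp
  fix k
  assume k: "1 \<le> k \<and> k \<le> ((CARD('n) + d - 1) choose d) - CARD('n)"
  show "openin (product_topology (\<lambda>_. projective_space) {..<k})
      (d_independent_configurations d k :: (nat \<Rightarrow> (real ^ 'n) set) set)"
    using assms by (rule openin_d_independent_configurations)
  have "k \<le> card (lattice_set d :: (real ^ 'n) set)" using k card by simp
  then obtain S :: "(real ^ 'n) set" where S: "S \<subseteq> lattice_set d" "card S = k" "finite S"
    by (rule obtain_subset_with_card_n)
  then obtain y where y: "bij_betw y {..<k} S"
    using ex_bij_betw_nat_finite[OF S(3)] by (auto simp: atLeast0LessThan)
  have "restrict (\<lambda>i. proj_point (y i)) {..<k} \<in> d_independent_configurations d k"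
    unfolding d_independent_configurations_iff
    using y d_independent_subset_lattice_set[OF assms S(1)]
    by (intro conjI exI[of _ y]) (auto simp: bij_betw_def)
  then show "(d_independent_configurations d k :: (nat \<Rightarrow> (real ^ 'n) set) set) \<noteq> {}" by blast
qed

end
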